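(* Let $\mathcal{L}$ be a submodule of $\mathbb{Z}^{n+1}$ of rank $n$ such that the associated lattice ideal $I(\mathcal{L})\subseteq\mathbb{C}[x_1,\dots,x_{n+1}]$ is a complete intersection. Then there exists a completely wired graph $G$ (with $n+1$ vertices, suitably identified with $\{1,\dots,n+1\}$) whose Laplacian lattice is $\mathcal{L}$, and hence $I(\mathcal{L})=I(G)^h$, where $I(G)^h$ is the homogenization of the toppling ideal of $G$ with respect to the indeterminate of the sink.
   Context: **Lattice ideals.** For a submodule $\Lambda\subseteq\mathbb{Z}^m$, the lattice ideal is $I(\Lambda)=\mathrm{Span}_{\mathbb{C}}\{x^u-x^v: u,v\in\mathbb{N}^m,\ u-v\in\Lambda\}\subseteq\mathbb{C}[x_1,\dots,x_m]$. For $\mathcal{L}\subseteq\mathbb{Z}^{n+1}$ of rank $n$ whose lattice ideal is homogeneous (equivalently, all $w\in\mathcal{L}$ have coordinate sum $0$), $I(\mathcal{L})$ is a complete intersection if it is generated by $n$ homogeneous polynomials (being a complete intersection includes being homogeneous). **Graphs.** A directed multigraph $G=(V,E)$ has a finite vertex set $V$ and edge set $E\subseteq V\times V$ with a weight function $\mathrm{wt}:V\times V\to\mathbb{N}$, $\mathrm{wt}(u,v)>0$ iff $(u,v)\in E$ (loops allowed). $\mathrm{outdeg}(v)=\sum_{u\in V}\mathrm{wt}(v,u)$. A sandpile graph $(V,E,s)$ is a directed multigraph with a vertex $s$ (the sink) that is globally accessible: from every vertex there is a directed path to $s$. The sink is absolute if $\mathrm{outdeg}(s)=0$. Write $\widetilde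 V=V\setminus\{s\}$. The Laplacian is $\Delta_G:\mathbb{Z}V\to\mathbb{Z}V$, $\Delta_G(v)=\mathrm{outdeg}(v)\,v-\sum_{u\in V}\mathrm{wt}(v,u)\,u$, and the Laplacian lattice is $\mathrm{im}(\Delta_G)$. The reduced Laplacian $\widetilde\Delta_G:\mathbb{Z}\widetilde V\to\mathbb{Z}\widetilde V$ is $\widetilde\Delta_G(v)=\mathrm{outdeg}(v)\,v-\sum_{u\in\widetilde V}\mathrm{wt}(v,u)\,u$, and the toppling ideal $I(G)$ is the lattice ideal of $\mathrm{im}(\widetilde\Delta_G)$, in the polynomial ring over $\mathbb{C}$ with one indeterminate per nonsink vertex. The homogenization of an ideal $I$ is $I^h=(f^h:f\in I)$, where $f^h=y^{\deg f}f(x_1/y,\dots,x_n/y)$ with $y$ the indeterminate corresponding to the sink. **Wirings.** A divisor on $G$ is an element of $\mathbb{Z}V$; divisors are linearly equivalent if their difference is in $\mathrm{im}(\Delta_G)$; $|D|$ is the set of divisors with nonnegative coefficients linearly equivalent to $D$. Let $G_i=(V_i,E_i,s_i)$, $i=1,2$, be vertex-disjoint sandpile graphs with weight functions $\mathrm{wt}_i$ and absolute sinks $s_i$. A wiring of $G_1$ into $G_2$ is a sandpile graph $G$ with vertex set $V_1\sqcup V_2$, absolute sink $s_2$, and weight function $\mathrm{wt}$ such that: $\mathrm{wt}=\mathrm{wt}_1$ on $\widetilde V_1\times V_1$; $\mathrm{wt}=\mathrm{wt}_2$ on $V_2\times V_2$; $\mathrm{wt}(u,v)=0$ for $(u,v)\in(\widetilde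 V_1\times V_2)\cup(V_2\times V_1)$; $\mathrm{wt}(s_1,v)>0$ for some $v\in V_2$; and the wiring divisor $D=\sum_{v\in V_1}\Delta_G(s_1)_v\,v$, regarded as a divisor on $G_1$, satisfies $|D|\neq\emptyset$. A graph is completely wired if it is a single vertex with no edges, or (recursively) a wiring of one completely wired graph into another. *)

theory Defs
  imports "HOL-Algebra.Free_Abelian_Groups" "HOL-Algebra.Ideal" Complex_Main
begin

section \<open>Polynomials in a given set of indeterminates\<close>

text \<open>A polynomial over the complex numbers is a finitely supported map from exponent vectors
  to coefficients; \<open>Poly_Mapping.single u 1\<close> is the monomial \<open>x\<^sup>u\<close>.\<close>

type_synonym 'v mpoly = "('v \<Rightarrow>\<^sub>0 nat) \<Rightarrow>\<^sub>0 complex"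

definition poly_ring :: "'v set \<Rightarrow> 'v mpoly ring" where
  "poly_ring S =
     \<lparr>carrier = {p. \<forall>u\<in>Poly_Mapping.keys p. Poly_Mapping.keys u \<subseteq> S},
      monoid.mult = (*), one = 1, ring.zero = 0, add = (+)\<rparr>"

definition poly_scale :: "complex \<Rightarrow> 'v mpoly \<Rightarrow> 'v mpoly" where
  "poly_scale c p = Poly_Mapping.single 0 c * p"

global_interpretation mpoly: vector_space poly_scale
proof
  fix a b :: complex and p q :: "'v mpoly"
  show "poly_scale a (p + q) = poly_scale a p + poly_scale a q"
    unfolding poly_scale_def by (rule distrib_left)
  show "poly_scale (a + b) p = poly_scale a p + poly_scale b p"
    unfolding poly_scale_def single_add by (rule distrib_right)
  have "Poly_Mapping.single (0 :: 'v \<Rightarrow>\<^sub>0 nat) (a * b)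
      = Poly_Mapping.single 0 a * Poly_Mapping.single 0 b"
    unfolding mult_single by simp
  then show "poly_scale a (poly_scale b p) = poly_scale (a * b) p"
    unfolding poly_scale_def by (simp only: mult.assoc)
  show "poly_scale 1 p = p"
    unfolding poly_scale_def single_one by (rule mult_1_left)
qed

lemma poly_ring_cring: "cring (poly_ring S)"
proof (rule cringI)
  have add: "p + q \<in> carrier (poly_ring S)"
    if "p \<in> carrier (poly_ring S)" "q \<in> carrier (poly_ring S)" for p q
    using that Poly_Mapping.keys_add[of p q] unfolding poly_ring_def by auto
  have uminus: "- p \<in> carrier (poly_ring S)" if "p \<in> carrier (poly_ring S)" for p
    using that unfolding poly_ring_def by simp
  have mult: "p * q \<in> carrier (poly_ring S)"
    if p: "p \<in> carrier (poly_ring S)" and q: "q \<in> carrier (poly_ring S)" for p q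
  proof -
    have "Poly_Mapping.keys u \<subseteq> S" if "u \<in> Poly_Mapping.keys (p * q)" for u
    proof -
      obtain a b where "u = a + b" "a \<in> Poly_Mapping.keys p" "b \<in> Poly_Mapping.keys q"
        using \<open>u \<in> Poly_Mapping.keys (p * q)\<close> Poly_Mapping.keys_mult[of p q] by blast
      then show ?thesis
        using p q Poly_Mapping.keys_add[of a b] unfolding poly_ring_def by simp blast
    qed
    then show ?thesis unfolding poly_ring_def by simp
  qed
  have zero: "0 \<in> carrier (poly_ring S)" and one: "1 \<in> carrier (poly_ring S)"
    unfolding poly_ring_def by simp_all
  have ops: "x \<oplus>\<^bsub>poly_ring S\<^esub> y = x + y" "x \<otimes>\<^bsub>poly_ring S\<^esub> y = x * y"
    "\<zero>\<^bsub>poly_ring S\<^esub> = 0" "\<one>\<^bsub>poly_ring S\<^esub> = 1" for x y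
    unfolding poly_ring_def by simp_all
  show "abelian_group (poly_ring S)"
  proof (rule abelian_groupI, unfold ops)
    fix p assume "p \<in> carrier (poly_ring S)"
    then show "\<exists>q\<in>carrier (poly_ring S). q + p = 0"
      using uminus by (intro bexI[of _ "- p"]) simp_all
  qed ((fact add zero) | rule add.assoc add.commute add_0_left)+
  show "Group.comm_monoid (poly_ring S)"
    by (rule comm_monoidI, unfold ops) ((fact mult one) | rule mult.assoc mult.commute mult_1_left)+
  show "(x \<oplus>\<^bsub>poly_ring S\<^esub> y) \<otimes>\<^bsub>poly_ring S\<^esub> z
      = x \<otimes>\<^bsub>poly_ring S\<^esub> z \<oplus>\<^bsub>poly_ring S\<^esub> y \<otimes>\<^bsub>poly_ring S\<^esub> z" for x y z
    unfolding ops by (rule distrib_right)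
qed

definition exp_deg :: "('v \<Rightarrow>\<^sub>0 nat) \<Rightarrow> nat" where
  "exp_deg u = (\<Sum>i\<in>Poly_Mapping.keys u. Poly_Mapping.lookup u i)"

text \<open>The zero polynomial is homogeneous of every degree.\<close>

definition homogeneous :: "'v mpoly \<Rightarrow> bool" where
  "homogeneous p \<longleftrightarrow> (\<exists>d. \<forall>u\<in>Poly_Mapping.keys p. exp_deg u = d)"

definition total_deg :: "'v mpoly \<Rightarrow> nat" where
  "total_deg p = Max (insert 0 (exp_deg ` Poly_Mapping.keys p))"

text \<open>\<open>y\<^sup>d f(x/y)\<close> with \<open>d = deg f\<close>: each term \<open>c x\<^sup>u\<close> of \<open>f\<close> becomes \<open>c x\<^sup>u y\<^sup>d\<^sup>-\<^sup>|\<^sup>u\<^sup>|\<close>.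
  Only applied to \<open>f\<close> in which \<open>y\<close> does not occur.\<close>

definition homogenize :: "'v \<Rightarrow> 'v mpoly \<Rightarrow> 'v mpoly" where
  "homogenize y f =
     (\<Sum>u\<in>Poly_Mapping.keys f.
        Poly_Mapping.single (u + Poly_Mapping.single y (total_deg f - exp_deg u))
          (Poly_Mapping.lookup f u))"

text \<open>For \<open>I\<close> an ideal of the polynomial ring in the indeterminates \<open>S - {y}\<close>, this is an ideal
  of the polynomial ring in the indeterminates \<open>S\<close>.\<close>

definition homogenization :: "'v set \<Rightarrow> 'v \<Rightarrow> 'v mpoly set \<Rightarrow> 'v mpoly set" where
  "homogenization S y I = genideal (poly_ring S) (homogenize y ` I)"


section \<open>Lattices and lattice ideals\<close>

text \<open>The lattice of integer vectors indexed by \<open>S\<close> is \<open>free_Abelian_group S\<close>, so its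
  submodules are its subgroups; each of them is free, and its rank is the size of a basis.
  The group operations of \<open>free_Abelian_group\<close> do not depend on the index set, so \<open>UNIV\<close>
  below only supplies addition and zero.\<close>

definition has_rank :: "('v \<Rightarrow>\<^sub>0 int) set \<Rightarrow> nat \<Rightarrow> bool" where
  "has_rank L r \<longleftrightarrow>
     (free_Abelian_group UNIV)\<lparr>carrier := L\<rparr> \<cong> free_Abelian_group {..<r}"

definition lattice_ideal :: "'v set \<Rightarrow> ('v \<Rightarrow>\<^sub>0 int) set \<Rightarrow> 'v mpoly set" where
  "lattice_ideal S L =
     mpoly.span {Poly_Mapping.single u 1 - Poly_Mapping.single v 1 | u v.
       Poly_Mapping.keys u \<subseteq> S \<and> Poly_Mapping.keys v \<subseteq> S \<and>
       Poly_Mapping.map int u - Poly_Mapping.map int v \<in> L}"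

text \<open>The generators may repeat or vanish, i.e. at most as many generators as the rank are
  allowed. The ideal is then generated by homogeneous elements, so homogeneity of the ideal
  needs no separate clause.\<close>

definition lattice_complete_intersection :: "'v set \<Rightarrow> ('v \<Rightarrow>\<^sub>0 int) set \<Rightarrow> bool" where
  "lattice_complete_intersection S L \<longleftrightarrow>
     (\<exists>r f. has_rank L r \<and>
        (\<forall>i<r. f i \<in> carrier (poly_ring S) \<and> homogeneous (f i)) \<and>
        lattice_ideal S L = genideal (poly_ring S) (f ` {..<r}))"


section \<open>Sandpile graphs\<close>

text \<open>The edge set is determined by the weights and therefore not a component of its own;
  \<open>sandpile_graph\<close> forces weights involving non-vertices to be zero.\<close>

record 'v multigraph =
  verts :: "'v set"
  wt :: "'v \<Rightarrow> 'v \<Rightarrow> nat"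
  sink :: 'v

definition edges :: "'v multigraph \<Rightarrow> ('v \<times> 'v) set" where
  "edges G = {(u, v). wt G u v > 0}"

definition sandpile_graph :: "'v multigraph \<Rightarrow> bool" where
  "sandpile_graph G \<longleftrightarrow>
     finite (verts G) \<and> edges G \<subseteq> verts G \<times> verts G \<and> sink G \<in> verts G \<and>
     (\<forall>v\<in>verts G. (v, sink G) \<in> (edges G)\<^sup>*)"

definition nonsink :: "'v multigraph \<Rightarrow> 'v set" where
  "nonsink G = verts G - {sink G}"

definition outdeg :: "'v multigraph \<Rightarrow> 'v \<Rightarrow> nat" where
  "outdeg G v = (\<Sum>u\<in>verts G. wt G v u)"

definition absolute_sink :: "'v multigraph \<Rightarrow> bool" where
  "absolute_sink G \<longleftrightarrow> outdeg G (sink G) = 0"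

definition laplacian :: "'v multigraph \<Rightarrow> ('v \<Rightarrow>\<^sub>0 int) \<Rightarrow> ('v \<Rightarrow>\<^sub>0 int)" where
  "laplacian G = frag_extend (\<lambda>v. frag_cmul (int (outdeg G v)) (frag_of v)
     - (\<Sum>u\<in>verts G. frag_cmul (int (wt G v u)) (frag_of u)))"

definition laplacian_lattice :: "'v multigraph \<Rightarrow> ('v \<Rightarrow>\<^sub>0 int) set" where
  "laplacian_lattice G = laplacian G ` carrier (free_Abelian_group (verts G))"

definition reduced_laplacian :: "'v multigraph \<Rightarrow> ('v \<Rightarrow>\<^sub>0 int) \<Rightarrow> ('v \<Rightarrow>\<^sub>0 int)" where
  "reduced_laplacian G = frag_extend (\<lambda>v. frag_cmul (int (outdeg G v)) (frag_of v)
     - (\<Sum>u\<in>nonsink G. frag_cmul (int (wt G v u)) (frag_of u)))"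

definition toppling_ideal :: "'v multigraph \<Rightarrow> 'v mpoly set" where
  "toppling_ideal G =
     lattice_ideal (nonsink G) (reduced_laplacian G ` carrier (free_Abelian_group (nonsink G)))"


section \<open>Wirings\<close>

definition linearly_equivalent :: "'v multigraph \<Rightarrow> ('v \<Rightarrow>\<^sub>0 int) \<Rightarrow> ('v \<Rightarrow>\<^sub>0 int) \<Rightarrow> bool" where
  "linearly_equivalent G D E \<longleftrightarrow> D - E \<in> laplacian_lattice G"

definition linear_system :: "'v multigraph \<Rightarrow> ('v \<Rightarrow>\<^sub>0 int) \<Rightarrow> ('v \<Rightarrow>\<^sub>0 int) set" where
  "linear_system G D =
     {E \<in> carrier (free_Abelian_group (verts G)).
        (\<forall>v\<in>verts G. Poly_Mapping.lookup E v \<ge> 0) \<and> linearly_equivalent G D E}"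

definition wiring_divisor :: "'v multigraph \<Rightarrow> 'v multigraph \<Rightarrow> ('v \<Rightarrow>\<^sub>0 int)" where
  "wiring_divisor G1 G =
     (\<Sum>v\<in>verts G1.
        frag_cmul (Poly_Mapping.lookup (laplacian G (frag_of (sink G1))) v) (frag_of v))"

definition is_wiring :: "'v multigraph \<Rightarrow> 'v multigraph \<Rightarrow> 'v multigraph \<Rightarrow> bool" where
  "is_wiring G1 G2 G \<longleftrightarrow>
     sandpile_graph G1 \<and> absolute_sink G1 \<and>
     sandpile_graph G2 \<and> absolute_sink G2 \<and>
     verts G1 \<inter> verts G2 = {} \<and>
     sandpile_graph G \<and> absolute_sink G \<and>
     verts G = verts G1 \<union> verts G2 \<and> sink G = sink G2 \<and>
     (\<forall>u\<in>nonsink G1. \<forall>v\<in>verts G1. wt G u v = wt G1 u v) \<and>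
     (\<forall>u\<in>verts G2. \<forall>v\<in>verts G2. wt G u v = wt G2 u v) \<and>
     (\<forall>u\<in>nonsink G1. \<forall>v\<in>verts G2. wt G u v = 0) \<and>
     (\<forall>u\<in>verts G2. \<forall>v\<in>verts G1. wt G u v = 0) \<and>
     (\<exists>v\<in>verts G2. wt G (sink G1) v > 0) \<and>
     linear_system G1 (wiring_divisor G1 G) \<noteq> {}"

inductive completely_wired :: "'v multigraph \<Rightarrow> bool" where
  single: "verts G = {sink G} \<Longrightarrow> edges G = {} \<Longrightarrow> completely_wired G"
| wired: "completely_wired G1 \<Longrightarrow> completely_wired G2 \<Longrightarrow> is_wiring G1 G2 G \<Longrightarrow> completely_wired G"

end

theory Submission
  imports Defs
begin

text \<open>The theorem follows from a combinatorial normal form for bases of the lattice \<open>L\<close>.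

  \<^emph>\<open>From the ideal to a matrix.\<close> Suppose that \<open>I(L)\<close> is generated by \<open>n\<close> homogeneous polynomials.
  Then all vectors of \<open>L\<close> have coordinate sum zero (\<open>lattice_coord_sum_zero\<close>), and by a graded
  Nakayama argument at most \<open>n\<close> binomials \<open>x\<^sup>a - x\<^sup>b\<close> with coprime monomials generate the ideal
  (\<open>binomial_generators\<close>). Two monomials whose difference is in the ideal are connected by multiples
  of these generators (\<open>binomial_span_invariant\<close>). It follows that the rows \<open>a - b\<close> generate \<open>L\<close>. It
  also follows that, for a nonempty proper set \<open>Z\<close> of columns, some row is nonzero and of one sign on
  \<open>Z\<close>: otherwise the two monomials of each generator would either both involve a variable from \<open>Z\<close>
  or both not, and this would carry over to all binomials in the ideal. But \<open>L\<close> has full rank in the hyperplane, so \<open>x\<^sub>j\<^sup>m - x\<^sub>l\<^sup>m\<close> is in the ideal for some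
  positive \<open>m\<close>, for \<open>j\<close> in \<open>Z\<close> and \<open>l\<close> outside (\<open>full_rank_torsion\<close>).

  \<^emph>\<open>From the matrix to a tree.\<close> A matrix with this separation property is dominating: \<open>k\<close> rows are
  never all mixed, i.e. with entries of both signs, on \<open>k\<close> columns
  (\<open>dominating_if_separating\<close>). A dominating matrix with one more column than rows has a row with
  exactly two nonzero entries. Merging the two columns and dropping the row preserves the
  hypotheses, and undoing this step inductively shows that the matrix is glued
  (\<open>dominating_imp_glued\<close>): one row is nonnegative on a block of columns and nonpositive on the
  complementary block, and the other rows live in the two blocks and form matrices of the same kind.

  \<^emph>\<open>From the tree to a graph.\<close> By induction the two blocks are the Laplacian lattices of completely
  wired graphs. The connecting row differs by a vector of the first lattice from a row that has the
  sign pattern of a Laplacian at the sink of the first graph. Wiring the first graph into the second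
  by this row gives the lattice \<open>L\<close>, and the nonnegative part of the connecting row witnesses that
  the wiring divisor is equivalent to an effective one (\<open>glued_imp_completely_wired\<close>).

  \<^emph>\<open>The homogenization.\<close> The toppling ideal is the lattice ideal of the projection of \<open>L\<close> that forgets
  the sink. Since \<open>L\<close> has coordinate sum zero, the projection loses nothing, and homogenizing restores
  the lattice ideal of \<open>L\<close> (\<open>homogenization_lattice_ideal\<close>).\<close>

section \<open>Gluing dominating matrices\<close>

definition mixed_on :: "'v set \<Rightarrow> ('v \<Rightarrow> int) \<Rightarrow> bool" where
  "mixed_on Z r \<longleftrightarrow> (\<exists>v\<in>Z. r v > 0) \<and> (\<exists>v\<in>Z. r v < 0)"

text \<open>The rows are indexed by \<open>I\<close> and the columns by \<open>V\<close>. Usually a matrix is called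
  dominating if it has no square submatrix all of whose rows are mixed. Since a mixed submatrix with
  more rows than columns contains a square one, it is equivalent for finite matrices to forbid all
  mixed submatrices with at least as many rows as columns.\<close>

definition dominating :: "'v set \<Rightarrow> 'i set \<Rightarrow> ('i \<Rightarrow> 'v \<Rightarrow> int) \<Rightarrow> bool" where
  "dominating V I M \<longleftrightarrow>
     (\<forall>R Z. R \<subseteq> I \<longrightarrow> R \<noteq> {} \<longrightarrow> Z \<subseteq> V \<longrightarrow> (\<forall>i\<in>R. mixed_on Z (M i)) \<longrightarrow> card R < card Z)"

text \<open>The connecting row \<open>i\<close> has a nonzero entry on each side: without one on the first block it would
  not tie the two blocks together, and a negative one on the second block becomes an edge that leads
  from the old sink into the second graph.\<close>

inductive glued :: "'v set \<Rightarrow> 'i set \<Rightarrow> ('i \<Rightarrow> 'v \<Rightarrow> int) \<Rightarrow> bool" where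
  single: "glued {v} {} M"
| join: "glued V1 I1 M \<Longrightarrow> glued V2 I2 M \<Longrightarrow> V1 \<inter> V2 = {} \<Longrightarrow>
    (\<forall>v\<in>V1. M i v \<ge> 0) \<Longrightarrow> (\<exists>v\<in>V1. M i v > 0) \<Longrightarrow>
    (\<forall>v\<in>V2. M i v \<le> 0) \<Longrightarrow> (\<exists>v\<in>V2. M i v < 0) \<Longrightarrow>
    (\<forall>v. v \<notin> V1 \<union> V2 \<longrightarrow> M i v = 0) \<Longrightarrow>
    glued (V1 \<union> V2) (insert i (I1 \<union> I2)) M"

lemma mixed_on_mono: "mixed_on Z r \<Longrightarrow> Z \<subseteq> Z' \<Longrightarrow> mixed_on Z' r"
  unfolding mixed_on_def by blast

lemma dominatingD:
  assumes "dominating V I M" "R \<subseteq> I" "R \<noteq> {}" "Z \<subseteq> V" "\<And>i. i \<in> R \<Longrightarrow> mixed_on Z (M i)"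
  shows "card R < card Z"
  using assms unfolding dominating_def by blast

lemma glued_cong:
  assumes "glued V I M" "\<And>i. i \<in> I \<Longrightarrow> M i = M' i"
  shows "glued V I M'"
  using assms
proof (induction rule: glued.induct)
  case (single v M)
  show ?case by (rule glued.single)
next
  case (join V1 I1 M V2 I2 i)
  have "M i = M' i" using join.prems by simp
  with join show ?case by (intro glued.join) auto
qed

lemma glued_support:
  assumes "glued V I M" "i \<in> I" "v \<notin> V"
  shows "M i v = 0"
  using assms by (induction rule: glued.induct) auto

definition merge :: "'v \<Rightarrow> 'v \<Rightarrow> ('v \<Rightarrow> int) \<Rightarrow> 'v \<Rightarrow> int" where
  "merge a b r = r(a := r a + r b, b := 0)"

lemma merge_simps:
  "a \<noteq> b \<Longrightarrow> merge a b r a = r a + r b"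
  "merge a b r b = 0"
  "v \<noteq> a \<Longrightarrow> v \<noteq> b \<Longrightarrow> merge a b r v = r v"
  unfolding merge_def by auto

text \<open>Splitting a vertex \<open>a\<close> into \<open>a\<close> and \<open>b\<close> keeps a matrix glued if a new row \<open>k\<close> ties the two
  together. In the tree of bipartitions the vertex \<open>a\<close> lies in one block at each level, and this
  block receives \<open>b\<close> as well, down to the leaf \<open>{a}\<close>, where \<open>k\<close> glues \<open>{a}\<close> to \<open>{b}\<close>. The sign
  hypothesis says that nothing cancels in the sum of the two columns, so the signs of the
  connecting rows survive the splitting, and rows of blocks without \<open>a\<close> vanish on both.\<close>

lemma glued_unmerge:
  assumes "glued V I M'"
    and "\<And>i. i \<in> I \<Longrightarrow> M' i = merge a b (M i)"
    and "\<And>i. i \<in> I \<Longrightarrow> (M i a \<ge> 0 \<and> M i b \<ge> 0) \<or> (M i a \<le> 0 \<and> M i b \<le> 0)"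
    and "a \<in> V" "b \<notin> V"
    and "M k a > 0" "M k b < 0" "\<And>v. v \<noteq> a \<Longrightarrow> v \<noteq> b \<Longrightarrow> M k v = 0"
  shows "glued (insert b V) (insert k I) M"
  using assms
proof (induction rule: glued.induct)
  case (single v M')
  have "glued ({a} \<union> {b}) (insert k ({} \<union> {})) M"
    using single by (intro glued.join glued.single) auto
  then show ?case using single by (simp add: insert_commute)
next
  case (join V1 I1 M' V2 I2 i)
  have ab: "a \<noteq> b" using join.prems(3,4) by blast
  have mi: "M' i = merge a b (M i)" using join.prems by simp
  have sg: "(M i a \<ge> 0 \<and> M i b \<ge> 0) \<or> (M i a \<le> 0 \<and> M i b \<le> 0)" using join.prems by simp
  have ma: "M' i a = M i a + M i b" unfolding mi using ab by (simp add: merge_simps)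
  have mo: "M' i v = M i v" if "v \<noteq> a" "v \<noteq> b" for v
    unfolding mi using that by (simp add: merge_simps)
  \<comment> \<open>a block that does not contain \<open>a\<close> does not feel the merging\<close>
  have unaffected: "glued W J M" if W: "glued W J M'" "a \<notin> W" "J \<subseteq> I1 \<union> I2" for W J
  proof (rule glued_cong[OF W(1)])
    fix j assume j: "j \<in> J"
    have mj: "M' j = merge a b (M j)" using join.prems j W(3) by auto
    have sj: "(M j a \<ge> 0 \<and> M j b \<ge> 0) \<or> (M j a \<le> 0 \<and> M j b \<le> 0)" using join.prems j W(3) by auto
    have "M j a + M j b = 0"
      using glued_support[OF W(1) j W(2)] unfolding mj using ab by (simp add: merge_simps)
    with sj have "M j a = 0" "M j b = 0" by auto
    then show "M' j = M j" unfolding mj merge_def by auto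
  qed
  have aV: "a \<in> V1 \<union> V2" and bV: "b \<notin> V1 \<union> V2" using join.prems by auto
  have zo: "\<forall>v. v \<notin> insert b (V1 \<union> V2) \<longrightarrow> M i v = 0"
  proof (intro allI impI)
    fix v assume v: "v \<notin> insert b (V1 \<union> V2)"
    then have "M' i v = 0" using join.hyps(8) by blast
    moreover have "v \<noteq> a" "v \<noteq> b" using v aV by auto
    ultimately show "M i v = 0" using mo by simp
  qed
  show ?case
  proof (cases "a \<in> V1")
    case True
    have "glued (insert b V1) (insert k I1) M"
      using True join.prems by (intro join.IH(1)) auto
    moreover have "glued V2 I2 M"
      using True join.hyps by (intro unaffected) auto
    ultimately have "glued (insert b V1 \<union> V2) (insert i (insert k I1 \<union> I2)) M"
    proof (rule glued.join)
      show "insert b V1 \<inter> V2 = {}" using join.hyps(3) bV by auto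
      have nn: "M i a + M i b \<ge> 0" using join.hyps(4) True unfolding ma[symmetric] by blast
      then show "\<forall>v\<in>insert b V1. 0 \<le> M i v"
        using join.hyps(4) sg mo by (smt (verit, best) insert_iff)
      show "\<exists>v\<in>insert b V1. 0 < M i v"
      proof -
        obtain v where v: "v \<in> V1" "M' i v > 0" using join.hyps(5) by blast
        then have "v \<noteq> b" using bV by auto
        show ?thesis
        proof (cases "v = a")
          case True then show ?thesis using v ma by (smt (verit) insert_iff)
        next
          case False then show ?thesis using v mo \<open>v \<noteq> b\<close> by auto
        qed
      qed
      have "M' i v = M i v" if "v \<in> V2" for v
        using that True join.hyps(3) bV by (intro mo) auto
      then show "\<forall>v\<in>V2. M i v \<le> 0" "\<exists>v\<in>V2. M i v < 0" using join.hyps by auto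
      show "\<forall>v. v \<notin> insert b V1 \<union> V2 \<longrightarrow> M i v = 0" using zo by auto
    qed
    then show ?thesis by (simp add: insert_commute)
  next
    case False
    then have True: "a \<in> V2" using join.prems by blast
    have "glued (insert b V2) (insert k I2) M"
      using True join.prems by (intro join.IH(2)) auto
    moreover have "glued V1 I1 M"
      using False join.hyps by (intro unaffected) auto
    ultimately have "glued (V1 \<union> insert b V2) (insert i (I1 \<union> insert k I2)) M"
    proof (intro glued.join[of V1 I1 M "insert b V2"])
      show "V1 \<inter> insert b V2 = {}" using join.hyps(3) bV by auto
      have nn: "M i a + M i b \<le> 0" using join.hyps(6) True unfolding ma[symmetric] by blast
      have np: "\<forall>v\<in>V2. M' i v \<le> 0" using join.hyps by blast
      with nn show "\<forall>v\<in>insert b V2. M i v \<le> 0"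
        using sg mo by (smt (verit, best) insert_iff)
      show "\<exists>v\<in>insert b V2. M i v < 0"
      proof -
        obtain v where v: "v \<in> V2" "M' i v < 0" using join.hyps(7) by blast
        then have "v \<noteq> b" using bV by auto
        show ?thesis
        proof (cases "v = a")
          case True then show ?thesis using v ma by (smt (verit) insert_iff)
        next
          case False then show ?thesis using v mo \<open>v \<noteq> b\<close> by auto
        qed
      qed
      have "M' i v = M i v" if "v \<in> V1" for v
        using that False bV by (intro mo) auto
      then show "\<forall>v\<in>V1. M i v \<ge> 0" "\<exists>v\<in>V1. M i v > 0" using join.hyps by auto
      show "\<forall>v. v \<notin> V1 \<union> insert b V2 \<longrightarrow> M i v = 0" using zo by auto
    qed
    then show ?thesis by (simp add: insert_commute)
  qed
qed

text \<open>If all rows stayed mixed after deleting column \<open>j\<close>, they would contradict dominance. So every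
  column \<open>j\<close> holds the only positive or the only negative entry of some row. There are more columns
  than rows, so one row serves two columns, and these must account for its two signs.\<close>

lemma dominating_elementary_row:
  assumes dom: "dominating V I M" and fin: "finite V" "finite I" and card: "card V = card I + 1"
    and "I \<noteq> {}" and mixed: "\<And>i. i \<in> I \<Longrightarrow> mixed_on V (M i)"
  obtains k a b where "k \<in> I" "a \<in> V" "b \<in> V" "M k a > 0" "M k b < 0"
    "\<And>v. v \<in> V \<Longrightarrow> v \<noteq> a \<Longrightarrow> v \<noteq> b \<Longrightarrow> M k v = 0"
proof -
  have "\<exists>i\<in>I. \<not> mixed_on (V - {j}) (M i)" if "j \<in> V" for j
  proof (rule ccontr)
    assume "\<not> ?thesis"
    then have "card I < card (V - {j})"
      by (intro dominatingD[OF dom]) (use \<open>I \<noteq> {}\<close> in auto)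
    then show False using card fin that by simp
  qed
  then obtain \<phi> where \<phi>: "\<And>j. j \<in> V \<Longrightarrow> \<phi> j \<in> I" "\<And>j. j \<in> V \<Longrightarrow> \<not> mixed_on (V - {j}) (M (\<phi> j))"
    by metis
  have "\<not> inj_on \<phi> V"
    using card_inj_on_le[of \<phi> V I] \<phi>(1) fin card by auto
  then obtain j l where jl: "j \<in> V" "l \<in> V" "j \<noteq> l" "\<phi> j = \<phi> l"
    unfolding inj_on_def by blast
  define k where "k = \<phi> j"
  have k: "k \<in> I" "\<not> mixed_on (V - {j}) (M k)" "\<not> mixed_on (V - {l}) (M k)"
    using \<phi> jl unfolding k_def by metis+
  obtain p q where pq: "p \<in> V" "M k p > 0" "q \<in> V" "M k q < 0"
    using mixed[OF k(1)] unfolding mixed_on_def by blast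
  have "p \<noteq> q" using pq by auto
  have j: "(\<forall>v\<in>V - {j}. M k v \<le> 0) \<or> (\<forall>v\<in>V - {j}. M k v \<ge> 0)"
    and l: "(\<forall>v\<in>V - {l}. M k v \<le> 0) \<or> (\<forall>v\<in>V - {l}. M k v \<ge> 0)"
    using k unfolding mixed_on_def by force+
  have one: "p = j \<and> q = l \<or> p = l \<and> q = j"
    using j l pq jl by (smt (verit) DiffI insertE singletonD)
  then have "M k v = 0" if "v \<in> V" "v \<noteq> p" "v \<noteq> q" for v
    using j l pq jl that by (smt (verit) DiffI insertE singletonD)
  with pq k(1) that show ?thesis by blast
qed

text \<open>Induction on the number of rows. The two columns \<open>a\<close>, \<open>b\<close> of an elementary row \<open>k\<close> are merged
  and \<open>k\<close> is dropped. A set of rows that becomes mixed on columns including \<open>a\<close> was mixed, together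
  with \<open>k\<close>, on the same columns and \<open>b\<close>, so the smaller matrix is dominating. No other row has
  opposite signs at \<open>a\<close> and \<open>b\<close>: with \<open>k\<close> it would form two rows mixed on two columns.\<close>

lemma dominating_imp_glued:
  assumes "dominating V I M" "finite V" "finite I" "card V = card I + 1"
    and "\<And>i. i \<in> I \<Longrightarrow> mixed_on V (M i)"
    and "\<And>i v. i \<in> I \<Longrightarrow> v \<notin> V \<Longrightarrow> M i v = 0"
  shows "glued V I M"
  using assms
proof (induction "card I" arbitrary: V I M)
  case 0
  then have "I = {}" "card V = 1" by auto
  then show ?case by (metis card_1_singletonE glued.single)
next
  case (Suc m)
  have "I \<noteq> {}" using Suc.hyps by auto
  then obtain k a b where k: "k \<in> I" "a \<in> V" "b \<in> V" "M k a > 0" "M k b < 0"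
    and k0: "\<And>v. v \<in> V \<Longrightarrow> v \<noteq> a \<Longrightarrow> v \<noteq> b \<Longrightarrow> M k v = 0"
    using dominating_elementary_row[OF Suc.prems(1-4)] Suc.prems(5) by metis
  have ab: "a \<noteq> b" using k by auto
  have sg: "(M i a \<ge> 0 \<and> M i b \<ge> 0) \<or> (M i a \<le> 0 \<and> M i b \<le> 0)" if i: "i \<in> I - {k}" for i
  proof (rule ccontr)
    assume "\<not> ?thesis"
    then have "mixed_on {a, b} (M i)" unfolding mixed_on_def by force
    moreover have "mixed_on {a, b} (M k)" using k unfolding mixed_on_def by auto
    ultimately have "card {i, k} < card {a, b}"
      using i k by (intro dominatingD[OF Suc.prems(1)]) auto
    then show False using i ab by auto
  qed
  define M' where "M' = (\<lambda>i. merge a b (M i))"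
  have "glued (V - {b}) (I - {k}) M'"
  proof (rule Suc.hyps)
    show "m = card (I - {k})" "card (V - {b}) = card (I - {k}) + 1"
      using Suc.hyps(2) Suc.prems k by auto
    show "dominating (V - {b}) (I - {k}) M'"
      unfolding dominating_def
    proof (intro allI impI)
      fix R Z assume R: "R \<subseteq> I - {k}" "R \<noteq> {}" and Z: "Z \<subseteq> V - {b}"
        and mx: "\<forall>i\<in>R. mixed_on Z (M' i)"
      have fR: "finite R" "finite Z" using R Z Suc.prems by (meson finite_Diff finite_subset)+
      show "card R < card Z"
      proof (cases "a \<in> Z")
        case False
        then have "\<forall>v\<in>Z. M' i v = M i v" for i using Z unfolding M'_def
          by (metis DiffE insertCI merge_simps(3) subset_iff)
        then have "\<forall>i\<in>R. mixed_on Z (M i)" using mx unfolding mixed_on_def by metis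
        then show ?thesis using R Z by (intro dominatingD[OF Suc.prems(1)]) auto
      next
        case True
        have "mixed_on (insert b Z) (M i)" if "i \<in> R" for i
        proof -
          obtain p q where pq: "p \<in> Z" "M' i p > 0" "q \<in> Z" "M' i q < 0"
            using mx \<open>i \<in> R\<close> unfolding mixed_on_def by blast
          have "p \<noteq> b" "q \<noteq> b" using pq Z by auto
          have "\<exists>v\<in>insert b Z. M i v > 0"
            using pq \<open>p \<noteq> b\<close> ab unfolding M'_def merge_def
            by (cases "p = a") (auto, smt (verit))
          moreover have "\<exists>v\<in>insert b Z. M i v < 0"
            using pq \<open>q \<noteq> b\<close> ab unfolding M'_def merge_def
            by (cases "q = a") (auto, smt (verit))
          ultimately show ?thesis unfolding mixed_on_def by blast
        qed
        moreover have "mixed_on (insert b Z) (M k)" using True k unfolding mixed_on_def by auto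
        ultimately have "card (insert k R) < card (insert b Z)"
          using R Z k by (intro dominatingD[OF Suc.prems(1)]) auto
        moreover have "k \<notin> R" "b \<notin> Z" using R Z by auto
        ultimately show ?thesis using fR by simp
      qed
    qed
    fix i assume i: "i \<in> I - {k}"
    obtain p q where pq: "p \<in> V" "M i p > 0" "q \<in> V" "M i q < 0"
      using Suc.prems(5)[of i] i unfolding mixed_on_def by blast
    show "mixed_on (V - {b}) (M' i)"
    proof -
      have "\<exists>v\<in>V - {b}. M' i v > 0"
        using pq sg[OF i] ab k(2) unfolding M'_def merge_def
        by (cases "p \<in> {a, b}") (force, force)
      moreover have "\<exists>v\<in>V - {b}. M' i v < 0"
        using pq sg[OF i] ab k(2) unfolding M'_def merge_def
        by (cases "q \<in> {a, b}") (force, force)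
      ultimately show ?thesis unfolding mixed_on_def by blast
    qed
    fix v assume "v \<notin> V - {b}"
    then show "M' i v = 0" using Suc.prems(6)[of i v] i k unfolding M'_def merge_def by auto
  qed (use Suc.prems in auto)
  then have "glued (insert b (V - {b})) (insert k (I - {k})) M"
  proof (rule glued_unmerge[where a = a])
    show "M k v = 0" if "v \<noteq> a" "v \<noteq> b" for v
      using that k0 k Suc.prems(6) by blast
    show "(M i a \<ge> 0 \<and> M i b \<ge> 0) \<or> (M i a \<le> 0 \<and> M i b \<le> 0)" if "i \<in> I - {k}" for i
      using that by (rule sg)
  qed (use k ab in \<open>simp_all add: M'_def\<close>)
  then show ?case using k by (simp add: insert_absorb insert_Diff)
qed

text \<open>As long as \<open>Z\<close> is not all of \<open>V\<close>, some row is nonzero but of one sign on \<open>Z\<close>. It is not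
  among rows that are mixed on \<open>Z\<close>, and one further column makes it mixed. So a set of columns \<open>Z\<close>
  and a set \<open>R\<close> of rows mixed on it grow at the same pace until \<open>Z = V\<close>, when at most \<open>card I\<close>
  rows have been used. Started from a single column and no row, the same count gives the number of
  rows.\<close>

lemma dominating_if_separating:
  fixes V :: "'v set" and I :: "'i set" and M :: "'i \<Rightarrow> 'v \<Rightarrow> int"
  assumes fin: "finite V" "finite I" and card: "card I < card V"
    and sep: "\<And>Z. Z \<subseteq> V \<Longrightarrow> Z \<noteq> {} \<Longrightarrow> Z \<noteq> V \<Longrightarrow>
        \<exists>i\<in>I. (\<exists>v\<in>Z. M i v \<noteq> 0) \<and> \<not> mixed_on Z (M i)"
    and mixed: "\<And>i. i \<in> I \<Longrightarrow> mixed_on V (M i)"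
  shows "dominating V I M" and "card V = card I + 1"
proof -
  have grow: "card V + card R \<le> card I + card Z"
    if "R \<subseteq> I" "Z \<subseteq> V" "Z \<noteq> {}" "\<forall>i\<in>R. mixed_on Z (M i)" for R Z
    using that
  proof (induction "card (V - Z)" arbitrary: R Z)
    case 0
    then have "Z = V" using fin by auto
    moreover have "card R \<le> card I" using 0 fin by (simp add: card_mono)
    ultimately show ?case by simp
  next
    case (Suc m)
    have "Z \<noteq> V" using Suc.hyps(2) by auto
    then obtain i v where i: "i \<in> I" "v \<in> Z" "M i v \<noteq> 0" "\<not> mixed_on Z (M i)"
      using sep[OF Suc.prems(2,3)] by blast
    obtain p q where pq: "p \<in> V" "M i p > 0" "q \<in> V" "M i q < 0"
      using mixed[OF i(1)] unfolding mixed_on_def by blast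
    have "\<exists>j\<in>V. mixed_on (insert j Z) (M i)"
    proof (cases "M i v > 0")
      case True
      then show ?thesis using i pq unfolding mixed_on_def by (intro bexI[of _ q]) auto
    next
      case False
      then have "M i v < 0" using i by simp
      then show ?thesis using i pq unfolding mixed_on_def by (intro bexI[of _ p]) auto
    qed
    then obtain j where j: "j \<in> V" "mixed_on (insert j Z) (M i)" by blast
    have jZ: "j \<notin> Z" using j i by (metis insert_absorb insert_Diff)
    have fZ: "finite Z" "finite R" using Suc.prems fin by (meson finite_subset)+
    have iR: "i \<notin> R" using Suc.prems i by blast
    have "V - Z = insert j (V - insert j Z)" using j jZ by auto
    then have "card (V - Z) = Suc (card (V - insert j Z))"
      using fin by (metis DiffD2 card_insert_disjoint finite_Diff insertI1)
    then have "card V + card (insert i R) \<le> card I + card (insert j Z)"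
      using Suc.prems i j Suc.hyps(2)
      by (intro Suc.hyps(1)) (auto simp: mixed_on_mono[OF _ subset_insertI])
    then show ?case using iR jZ fZ by simp
  qed
  show "dominating V I M" unfolding dominating_def
  proof (intro allI impI)
    fix R Z assume RZ: "R \<subseteq> I" "R \<noteq> {}" "Z \<subseteq> V" "\<forall>i\<in>R. mixed_on Z (M i)"
    then have "Z \<noteq> {}" unfolding mixed_on_def by blast
    with RZ have "card V + card R \<le> card I + card Z" by (intro grow)
    then show "card R < card Z" using card by simp
  qed
  obtain j where "j \<in> V" using card by fastforce
  then have "card V + card ({} :: 'i set) \<le> card I + card {j}" by (intro grow) auto
  then show "card V = card I + 1" using card by simp
qed

section \<open>From glued matrices to completely wired graphs\<close>

text \<open>Subgroups of a lattice are submodules over the integers; this makes spans and linear maps from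
  the theory of modules available for them.\<close>

global_interpretation frag: module "frag_cmul :: int \<Rightarrow> ('v \<Rightarrow>\<^sub>0 int) \<Rightarrow> ('v \<Rightarrow>\<^sub>0 int)"
  by standard (simp_all add: frag_cmul_distrib frag_cmul_distrib2)

text \<open>As rewrite rules, this and its counterpart from the module interpretation would undo each
  other.\<close>

declare minus_frag_cmul [simp del]

lemmas lookup_frag = lookup_add lookup_minus lookup_sum

definition restrict_frag :: "'v set \<Rightarrow> ('v \<Rightarrow>\<^sub>0 int) \<Rightarrow> ('v \<Rightarrow>\<^sub>0 int)" where
  "restrict_frag V c = (\<Sum>v\<in>V. frag_cmul (Poly_Mapping.lookup c v) (frag_of v))"

lemma lookup_restrict_frag:
  assumes "finite V"
  shows "Poly_Mapping.lookup (restrict_frag V c) v = (if v \<in> V then Poly_Mapping.lookup c v else 0)"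
proof -
  have "Poly_Mapping.lookup (restrict_frag V c) v
      = (\<Sum>u\<in>V. if u = v then Poly_Mapping.lookup c v else 0)"
    unfolding restrict_frag_def lookup_sum
    by (intro sum.cong) (auto simp: lookup_frag)
  then show ?thesis using assms by simp
qed

lemma restrict_frag_keys:
  assumes "finite V" "Poly_Mapping.keys c \<subseteq> V"
  shows "restrict_frag V c = c"
  using assms by (intro poly_mapping_eqI) (auto simp: lookup_restrict_frag in_keys_iff)

lemma frag_span_keys_in:
  assumes "c \<in> frag.span T" "\<And>t. t \<in> T \<Longrightarrow> Poly_Mapping.keys t \<subseteq> V"
  shows "Poly_Mapping.keys c \<subseteq> V"
  using assms(1)
proof (induction rule: frag.span_induct_alt)
  case base then show ?case by simp
next
  case (step k t c)
  then show ?case using assms(2)[of t] keys_add[of "frag_cmul k t" c] keys_cmul[of k t] by blast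
qed

lemma carrier_free_eq_span:
  assumes "finite V"
  shows "carrier (free_Abelian_group V) = frag.span (frag_of ` V)"
proof
  show "frag.span (frag_of ` V) \<subseteq> carrier (free_Abelian_group V)"
    using frag_span_keys_in[where T = "frag_of ` V" and V = V] by fastforce
  show "carrier (free_Abelian_group V) \<subseteq> frag.span (frag_of ` V)"
  proof
    fix c :: "'a \<Rightarrow>\<^sub>0 int" assume "c \<in> carrier (free_Abelian_group V)"
    then have "c = restrict_frag V c" by (simp add: restrict_frag_keys[OF assms])
    also have "\<dots> \<in> frag.span (frag_of ` V)"
      unfolding restrict_frag_def by (intro frag.span_sum frag.span_scale frag.span_base) auto
    finally show "c \<in> frag.span (frag_of ` V)" .
  qed
qed

lemma frag_extend_hom: "module_hom frag_cmul frag_cmul (frag_extend b)"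
  by (intro module_hom.intro frag.module_axioms module_hom_axioms.intro)
     (simp_all add: frag_extend_add frag_extend_cmul)

lemma laplacian_lattice_eq_span:
  assumes "finite (verts G)"
  shows "laplacian_lattice G = frag.span ((\<lambda>v. laplacian G (frag_of v)) ` verts G)"
proof -
  interpret module_hom frag_cmul frag_cmul "laplacian G"
    unfolding laplacian_def by (rule frag_extend_hom)
  show ?thesis
    unfolding laplacian_lattice_def carrier_free_eq_span[OF assms] span_image[symmetric] image_image ..
qed

lemma lookup_laplacian:
  assumes "finite (verts G)"
  shows "Poly_Mapping.lookup (laplacian G (frag_of u)) v =
    (if v = u then int (outdeg G u) else 0) - (if v \<in> verts G then int (wt G u v) else 0)"
proof -
  have "Poly_Mapping.lookup (\<Sum>w\<in>verts G. frag_cmul (int (wt G u w)) (frag_of w)) v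
      = (\<Sum>w\<in>verts G. if w = v then int (wt G u v) else 0)"
    unfolding lookup_sum by (intro sum.cong) (auto simp: lookup_frag)
  then show ?thesis using assms unfolding laplacian_def by (simp add: lookup_frag)
qed

definition coord_sum :: "('v \<Rightarrow>\<^sub>0 int) \<Rightarrow> int" where
  "coord_sum c = (\<Sum>v\<in>Poly_Mapping.keys c. Poly_Mapping.lookup c v)"

lemma coord_sum_eq:
  assumes "finite V" "Poly_Mapping.keys c \<subseteq> V"
  shows "coord_sum c = (\<Sum>v\<in>V. Poly_Mapping.lookup c v)"
  unfolding coord_sum_def using assms
  by (intro sum.mono_neutral_left) (auto simp: in_keys_iff)

lemma coord_sum_add: "coord_sum (c + d) = coord_sum c + coord_sum d"
proof -
  let ?V = "Poly_Mapping.keys c \<union> Poly_Mapping.keys d"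
  have "coord_sum (c + d) = (\<Sum>v\<in>?V. Poly_Mapping.lookup (c + d) v)"
    by (intro coord_sum_eq) (auto simp: keys_add)
  moreover have "coord_sum c = (\<Sum>v\<in>?V. Poly_Mapping.lookup c v)"
    "coord_sum d = (\<Sum>v\<in>?V. Poly_Mapping.lookup d v)" by (auto intro!: coord_sum_eq)
  ultimately show ?thesis by (simp add: lookup_add sum.distrib)
qed

lemma coord_sum_cmul: "coord_sum (frag_cmul k c) = k * coord_sum c"
proof -
  have "coord_sum (frag_cmul k c) = (\<Sum>v\<in>Poly_Mapping.keys c. Poly_Mapping.lookup (frag_cmul k c) v)"
    using keys_cmul by (intro coord_sum_eq) auto
  then show ?thesis by (simp add: lookup_frag coord_sum_def sum_distrib_left)
qed

lemma coord_sum_diff: "coord_sum (c - d) = coord_sum c - coord_sum d"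
  using coord_sum_add[of "c - d" d] by simp

lemma coord_sum_span:
  assumes "c \<in> frag.span T" "\<And>t. t \<in> T \<Longrightarrow> coord_sum t = 0"
  shows "coord_sum c = 0"
  using assms(1)
proof (induction rule: frag.span_induct_alt)
  case base then show ?case by (simp add: coord_sum_def)
next
  case (step k t c)
  then show ?case using assms(2) by (simp add: coord_sum_add coord_sum_cmul)
qed

lemma glued_finite: "glued V I M \<Longrightarrow> finite V"
  by (induction rule: glued.induct) auto

lemma glued_span_keys:
  assumes "glued V I (\<lambda>i. Poly_Mapping.lookup (r i))" "c \<in> frag.span (r ` I)"
  shows "Poly_Mapping.keys c \<subseteq> V"
  using glued_support[OF assms(1)] by (intro frag_span_keys_in[OF assms(2)]) (auto simp: in_keys_iff)

text \<open>Descends the tree of bipartitions. Suppose that \<open>s\<close> lies in the block on which the connecting row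
  \<open>q\<close> may be negative, and let \<open>t\<close> be a place of the other block with \<open>q t > 0\<close>. A large multiple of
  \<open>q\<close> repairs the entry at \<open>t\<close> of a vector that is positive elsewhere on the first block, and a still
  larger multiple of a vector for the second block then outweighs \<open>q\<close> there.\<close>

lemma glued_span_positive:
  assumes "glued V I (\<lambda>i. Poly_Mapping.lookup (r i))" "s \<in> V"
  shows "\<exists>c\<in>frag.span (r ` I). \<forall>v\<in>V - {s}. Poly_Mapping.lookup c v > 0"
  using assms
proof (induction V I "\<lambda>i. Poly_Mapping.lookup (r i)" arbitrary: s rule: glued.induct)
  case (single v)
  then show ?case by (intro bexI[of _ 0]) (auto intro: frag.span_zero)
next
  case (join V1 I1 V2 I2 i)
  \<comment> \<open>both blocks play the same part, up to the sign of the connecting row\<close>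
  have general: "\<exists>c\<in>frag.span (insert q (T1 \<union> T2)). \<forall>v\<in>W1 \<union> W2 - {s}. Poly_Mapping.lookup c v > 0"
    if fin: "finite W1" "finite W2" and disj: "W1 \<inter> W2 = {}" and s: "s \<in> W2"
      and q: "\<forall>v\<in>W1. Poly_Mapping.lookup q v \<ge> 0" and t: "t \<in> W1" "Poly_Mapping.lookup q t > 0"
      and c1: "c1 \<in> frag.span T1" "\<forall>v\<in>W1 - {t}. Poly_Mapping.lookup c1 v > 0"
        "Poly_Mapping.keys c1 \<subseteq> W1"
      and c2: "c2 \<in> frag.span T2" "\<forall>v\<in>W2 - {s}. Poly_Mapping.lookup c2 v > 0"
        "Poly_Mapping.keys c2 \<subseteq> W2"
    for W1 W2 T1 T2 q t c1 c2
  proof -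
    \<comment> \<open>the summand 1 makes both multipliers positive even if the other entries vanish\<close>
    define N where "N = \<bar>Poly_Mapping.lookup c1 t\<bar> + 1"
    define K where "K = (\<Sum>v\<in>W2. \<bar>N * Poly_Mapping.lookup q v\<bar>) + 1"
    define c where "c = frag_cmul N q + c1 + frag_cmul K c2"
    have "frag.span T1 \<subseteq> frag.span (insert q (T1 \<union> T2))" "frag.span T2 \<subseteq> frag.span (insert q (T1 \<union> T2))"
      by (intro frag.span_mono; auto)+
    then have "c \<in> frag.span (insert q (T1 \<union> T2))"
      unfolding c_def using c1 c2
      by (intro frag.span_add frag.span_scale) (auto intro: frag.span_base)
    moreover have "Poly_Mapping.lookup c v > 0" if v: "v \<in> W1" for v
    proof -
      have z: "Poly_Mapping.lookup c2 v = 0" using c2(3) v disj by (auto simp: in_keys_iff)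
      show ?thesis
      proof (cases "v = t")
        case True
        have "N * Poly_Mapping.lookup q t \<ge> N * 1"
          using t(2) by (intro mult_left_mono) (auto simp: N_def)
        moreover have "N * 1 + Poly_Mapping.lookup c1 t > 0" by (simp add: N_def)
        ultimately have "N * Poly_Mapping.lookup q t + Poly_Mapping.lookup c1 t > 0"
          by linarith
        then show ?thesis using z True by (simp add: c_def lookup_frag)
      next
        case False
        have "N * Poly_Mapping.lookup q v \<ge> 0" using q v by (simp add: N_def)
        moreover have "Poly_Mapping.lookup c1 v > 0" using c1(2) v False by simp
        ultimately show ?thesis using z by (simp add: c_def lookup_frag)
      qed
    qed
    moreover have "Poly_Mapping.lookup c v > 0" if v: "v \<in> W2" "v \<noteq> s" for v
    proof -
      have z: "Poly_Mapping.lookup c1 v = 0" using c1(3) v disj by (auto simp: in_keys_iff)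
      have "\<bar>N * Poly_Mapping.lookup q v\<bar> \<le> (\<Sum>v\<in>W2. \<bar>N * Poly_Mapping.lookup q v\<bar>)"
        using fin v by (intro member_le_sum) auto
      then have "N * Poly_Mapping.lookup q v + K > 0" unfolding K_def by linarith
      moreover have "K * Poly_Mapping.lookup c2 v \<ge> K * 1"
        using c2(2) v by (intro mult_left_mono) (force, auto simp: K_def intro: sum_nonneg add_nonneg_nonneg)
      ultimately have "N * Poly_Mapping.lookup q v + K * Poly_Mapping.lookup c2 v > 0" by linarith
      then show ?thesis using z by (simp add: c_def lookup_frag)
    qed
    ultimately show ?thesis by blast
  qed
  note keys1 = glued_span_keys[OF join.hyps(1)] and keys2 = glued_span_keys[OF join.hyps(3)]
    and fin = glued_finite[OF join.hyps(1)] glued_finite[OF join.hyps(3)]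
  obtain t where t: "t \<in> V1" "Poly_Mapping.lookup (r i) t > 0" using join.hyps by blast
  obtain t' where t': "t' \<in> V2" "Poly_Mapping.lookup (r i) t' < 0" using join.hyps by blast
  show ?case
  proof (cases "s \<in> V2")
    case True
    obtain c1 where c1: "c1 \<in> frag.span (r ` I1)" "\<forall>v\<in>V1 - {t}. Poly_Mapping.lookup c1 v > 0"
      using join.hyps(2)[OF t(1)] by blast
    obtain c2 where c2: "c2 \<in> frag.span (r ` I2)" "\<forall>v\<in>V2 - {s}. Poly_Mapping.lookup c2 v > 0"
      using join.hyps(4)[OF True] by blast
    have "\<exists>c\<in>frag.span (insert (r i) (r ` I1 \<union> r ` I2)). \<forall>v\<in>V1 \<union> V2 - {s}. Poly_Mapping.lookup c v > 0"
      by (rule general[OF fin join.hyps(5) True join.hyps(6) t c1 keys1[OF c1(1)] c2 keys2[OF c2(1)]])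
    then show ?thesis by (simp add: image_Un)
  next
    case False
    then have s: "s \<in> V1" using join by blast
    obtain c1 where c1: "c1 \<in> frag.span (r ` I2)" "\<forall>v\<in>V2 - {t'}. Poly_Mapping.lookup c1 v > 0"
      using join.hyps(4)[OF t'(1)] by blast
    obtain c2 where c2: "c2 \<in> frag.span (r ` I1)" "\<forall>v\<in>V1 - {s}. Poly_Mapping.lookup c2 v > 0"
      using join.hyps(2)[OF s] by blast
    have "\<exists>c\<in>frag.span (insert (- r i) (r ` I2 \<union> r ` I1)). \<forall>v\<in>V2 \<union> V1 - {s}. Poly_Mapping.lookup c v > 0"
      by (rule general[OF fin(2,1) _ s _ t'(1) _ c1 keys2[OF c1(1)] c2 keys1[OF c2(1)]])
        (use join.hyps(5,8) t' in \<open>auto simp: Int_commute\<close>)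
    moreover have "frag.span (insert (- r i) (r ` I2 \<union> r ` I1)) \<subseteq> frag.span (r ` insert i (I1 \<union> I2))"
      by (intro frag.span_minimal frag.subspace_span)
        (auto intro!: frag.span_neg intro: frag.span_base)
    ultimately show ?thesis by (auto simp: Un_commute)
  qed
qed

lemma sandpile_wt_zero:
  assumes "sandpile_graph G" "u \<notin> verts G \<or> v \<notin> verts G"
  shows "wt G u v = 0"
  using assms unfolding sandpile_graph_def edges_def by auto

lemma absolute_sink_wt_zero:
  assumes "sandpile_graph G" "absolute_sink G"
  shows "wt G (sink G) v = 0"
proof (cases "v \<in> verts G")
  case True
  then show ?thesis using assms unfolding absolute_sink_def outdeg_def sandpile_graph_def by simp
next
  case False
  then show ?thesis using sandpile_wt_zero[OF assms(1)] by simp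
qed

text \<open>The Laplacian of the old sink \<open>s\<^sub>1\<close> may be prescribed to be any vector \<open>d\<close> that looks like a
  Laplacian: coordinate sum zero and nonpositive away from \<open>s\<^sub>1\<close>. All other rows are those of the
  two given graphs, which contribute no edges at their absolute sinks.\<close>

lemma wiring_exists:
  assumes G1: "sandpile_graph G1" "absolute_sink G1" and G2: "sandpile_graph G2" "absolute_sink G2"
    and disj: "verts G1 \<inter> verts G2 = {}"
    and d: "Poly_Mapping.keys d \<subseteq> verts G1 \<union> verts G2" "coord_sum d = 0"
      "\<And>v. v \<noteq> sink G1 \<Longrightarrow> Poly_Mapping.lookup d v \<le> 0"
      "\<exists>v\<in>verts G2. Poly_Mapping.lookup d v < 0"
    and eff: "linear_system G1 (restrict_frag (verts G1) d) \<noteq> {}"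
  shows "\<exists>G. is_wiring G1 G2 G \<and>
    laplacian_lattice G = frag.span (insert d (laplacian_lattice G1 \<union> laplacian_lattice G2))"
proof -
  let ?s = "sink G1" and ?V1 = "verts G1" and ?V2 = "verts G2"
  have s: "?s \<in> ?V1" "sink G2 \<in> ?V2" "?s \<notin> ?V2" and fin: "finite ?V1" "finite ?V2"
    using G1 G2 disj unfolding sandpile_graph_def by auto
  define G where "G = \<lparr>verts = ?V1 \<union> ?V2,
     wt = (\<lambda>u v. if u = ?s then (if v = ?s then 0 else nat (- Poly_Mapping.lookup d v))
        else if u \<in> ?V1 then wt G1 u v else wt G2 u v),
     sink = sink G2\<rparr>"
  have [simp]: "verts G = ?V1 \<union> ?V2" "sink G = sink G2" unfolding G_def by simp_all
  have finG: "finite (verts G)" using fin by simp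
  have wts: "wt G ?s v = (if v = ?s then 0 else nat (- Poly_Mapping.lookup d v))" for v
    unfolding G_def by simp
  have wt1: "wt G u v = wt G1 u v" if "u \<in> ?V1" "u \<noteq> ?s" for u v
    using that unfolding G_def by simp
  have wt2: "wt G u v = wt G2 u v" if "u \<notin> ?V1" for u v
    using that s unfolding G_def by auto
  have d0: "Poly_Mapping.lookup d v = 0" if "v \<notin> ?V1 \<union> ?V2" for v
    using that d(1) by (auto simp: in_keys_iff)
  have e1: "edges G1 \<subseteq> edges G"
  proof (clarsimp simp: edges_def)
    fix u v assume uv: "0 < wt G1 u v"
    then have "u \<in> ?V1" "u \<noteq> ?s"
      using sandpile_wt_zero[OF G1(1)] absolute_sink_wt_zero[OF G1] by (metis less_irrefl)+
    then show "0 < wt G u v" using uv wt1 by simp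
  qed
  have e2: "edges G2 \<subseteq> edges G"
  proof (clarsimp simp: edges_def)
    fix u v assume uv: "0 < wt G2 u v"
    then have "u \<in> ?V2" using sandpile_wt_zero[OF G2(1)] by (metis less_irrefl)
    then have "u \<notin> ?V1" using disj by auto
    then show "0 < wt G u v" using uv wt2 by simp
  qed
  obtain t where t: "t \<in> ?V2" "Poly_Mapping.lookup d t < 0" using d(4) by blast
  have st: "wt G ?s t > 0" using t s wts by auto
  have sub: "edges G \<subseteq> verts G \<times> verts G"
  proof (clarify, rule ccontr)
    fix u v assume uv: "(u, v) \<in> edges G" and "\<not> (u \<in> verts G \<and> v \<in> verts G)"
    then have "wt G u v = 0"
      using sandpile_wt_zero[OF G1(1)] sandpile_wt_zero[OF G2(1)] d0[of v] s unfolding G_def by auto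
    then show False using uv unfolding edges_def by simp
  qed
  have r2: "(v, sink G) \<in> (edges G)\<^sup>*" if "v \<in> ?V2" for v
  proof -
    have "(v, sink G2) \<in> (edges G2)\<^sup>*" using that G2 unfolding sandpile_graph_def by blast
    then show ?thesis using rtrancl_mono[OF e2] by auto
  qed
  have r1: "(v, sink G) \<in> (edges G)\<^sup>*" if "v \<in> ?V1" for v
  proof -
    have "(v, ?s) \<in> (edges G1)\<^sup>*" using that G1 unfolding sandpile_graph_def by blast
    then have "(v, ?s) \<in> (edges G)\<^sup>*" using rtrancl_mono[OF e1] by auto
    moreover have "(?s, t) \<in> edges G" using st unfolding edges_def by simp
    ultimately show ?thesis using r2[OF t(1)] by (meson rtrancl.rtrancl_into_rtrancl rtrancl_trans)
  qed
  have sg: "sandpile_graph G"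
    unfolding sandpile_graph_def using finG sub s r1 r2 by auto
  have od2: "outdeg G u = outdeg G2 u" if "u \<notin> ?V1" for u
  proof -
    have "(\<Sum>v\<in>?V1. wt G2 u v) = 0" using sandpile_wt_zero[OF G2(1)] disj by (intro sum.neutral) blast
    then show ?thesis unfolding outdeg_def using wt2[OF that] fin disj by (simp add: sum.union_disjoint)
  qed
  have od1: "outdeg G u = outdeg G1 u" if "u \<in> ?V1" "u \<noteq> ?s" for u
  proof -
    have "(\<Sum>v\<in>?V2. wt G1 u v) = 0" using sandpile_wt_zero[OF G1(1)] disj by (intro sum.neutral) blast
    then show ?thesis unfolding outdeg_def using wt1[OF that] fin disj by (simp add: sum.union_disjoint)
  qed
  have ods: "int (outdeg G ?s) = Poly_Mapping.lookup d ?s"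
  proof -
    have "int (outdeg G ?s) = (\<Sum>v\<in>?V1 \<union> ?V2 - {?s}. int (wt G ?s v))"
      unfolding outdeg_def using fin s wts by (simp add: sum.remove[of _ ?s])
    also have "\<dots> = (\<Sum>v\<in>?V1 \<union> ?V2 - {?s}. - Poly_Mapping.lookup d v)"
      using d(3) wts by (intro sum.cong) auto
    also have "\<dots> = - (\<Sum>v\<in>?V1 \<union> ?V2 - {?s}. Poly_Mapping.lookup d v)" by (rule sum_negf)
    also have "(\<Sum>v\<in>?V1 \<union> ?V2 - {?s}. Poly_Mapping.lookup d v) = coord_sum d - Poly_Mapping.lookup d ?s"
      using fin s coord_sum_eq[of "?V1 \<union> ?V2" d] d(1) by (simp add: sum.remove[of _ ?s])
    finally show ?thesis using d(2) by simp
  qed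
  have as: "absolute_sink G"
    using G2(2) od2[of "sink G2"] s disj unfolding absolute_sink_def by auto
  have ls: "laplacian G (frag_of ?s) = d"
    using ods d(3) d0 s wts
    by (intro poly_mapping_eqI) (auto simp: lookup_laplacian[OF finG])
  have l1: "laplacian G (frag_of u) = laplacian G1 (frag_of u)" if "u \<in> ?V1" "u \<noteq> ?s" for u
    using od1[OF that] wt1[OF that] sandpile_wt_zero[OF G1(1)] that
    by (intro poly_mapping_eqI) (auto simp: lookup_laplacian[OF finG] lookup_laplacian[OF fin(1)])
  have l2: "laplacian G (frag_of u) = laplacian G2 (frag_of u)" if "u \<in> ?V2" for u
  proof -
    have "u \<notin> ?V1" using that disj by auto
    from od2[OF this] wt2[OF this] sandpile_wt_zero[OF G2(1)] that show ?thesis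
      by (intro poly_mapping_eqI) (auto simp: lookup_laplacian[OF finG] lookup_laplacian[OF fin(2)])
  qed
  have l1s: "laplacian G1 (frag_of ?s) = 0"
    using G1(2) absolute_sink_wt_zero[OF G1] unfolding absolute_sink_def
    by (intro poly_mapping_eqI) (auto simp: lookup_laplacian[OF fin(1)])
  let ?S1 = "(\<lambda>v. laplacian G1 (frag_of v)) ` ?V1" and ?S2 = "(\<lambda>v. laplacian G2 (frag_of v)) ` ?V2"
  let ?S = "(\<lambda>v. laplacian G (frag_of v)) ` verts G"
  have lat: "laplacian_lattice G = frag.span (insert d (laplacian_lattice G1 \<union> laplacian_lattice G2))"
    unfolding laplacian_lattice_eq_span[OF finG] laplacian_lattice_eq_span[OF fin(1)]
      laplacian_lattice_eq_span[OF fin(2)]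
    unfolding frag.span_eq
  proof
    show "?S \<subseteq> frag.span (insert d (frag.span ?S1 \<union> frag.span ?S2))"
    proof (rule image_subsetI)
      fix u assume "u \<in> verts G"
      then consider "u = ?s" | "u \<in> ?V1" "u \<noteq> ?s" | "u \<in> ?V2" by auto
      then have "laplacian G (frag_of u) \<in> insert d (?S1 \<union> ?S2)"
        by cases (auto simp: ls l1 l2)
      then show "laplacian G (frag_of u) \<in> frag.span (insert d (frag.span ?S1 \<union> frag.span ?S2))"
        by (intro frag.span_base) (auto intro: frag.span_base)
    qed
    have m1: "?S1 \<subseteq> frag.span ?S"
    proof (rule image_subsetI)
      fix u assume u: "u \<in> ?V1"
      show "laplacian G1 (frag_of u) \<in> frag.span ?S"
      proof (cases "u = ?s")
        case True then show ?thesis using l1s by (simp add: frag.span_zero)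
      next
        case False then show ?thesis using u l1[symmetric] by (auto intro!: frag.span_base)
      qed
    qed
    moreover have "?S2 \<subseteq> frag.span ?S" using l2[symmetric] by (auto intro!: frag.span_base)
    moreover have "d \<in> frag.span ?S" using ls s by (auto intro!: frag.span_base)
    ultimately show "insert d (frag.span ?S1 \<union> frag.span ?S2) \<subseteq> frag.span ?S"
      using frag.span_minimal[OF m1 frag.subspace_span]
        frag.span_minimal[of ?S2, OF _ frag.subspace_span[of ?S]] by (simp only: insert_subset Un_subset_iff)
  qed
  have "wiring_divisor G1 G = restrict_frag ?V1 d"
    unfolding wiring_divisor_def restrict_frag_def ls ..
  moreover have "wt G u v = 0" if "u \<in> nonsink G1" "v \<in> ?V2" for u v
    using that wt1[of u v] sandpile_wt_zero[OF G1(1), of u v] disj unfolding nonsink_def by auto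
  moreover have "wt G u v = wt G2 u v" if "u \<in> ?V2" for u v
    using that disj by (intro wt2) auto
  moreover have "wt G2 u v = 0" if "u \<in> ?V2" "v \<in> ?V1" for u v
    using that sandpile_wt_zero[OF G2(1), of u v] disj by auto
  ultimately have "is_wiring G1 G2 G"
    unfolding is_wiring_def using G1 G2 disj sg as eff st t wt1
    by (auto simp: nonsink_def)
  with lat show ?thesis by blast
qed

text \<open>Let \<open>G\<^sub>1\<close> and \<open>G\<^sub>2\<close> belong to the two blocks. The connecting row \<open>r i\<close> is nonnegative on \<open>V1\<close>,
  whereas the Laplacian of the sink of \<open>G\<^sub>1\<close> must be nonpositive away from it. Subtracting a large
  multiple of a lattice vector of \<open>G\<^sub>1\<close> that is positive off the sink achieves this, and the
  restriction of \<open>r i\<close> to \<open>V1\<close> remains as an effective divisor equivalent to the wiring divisor.\<close>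

theorem glued_imp_completely_wired:
  assumes "glued V I (\<lambda>i. Poly_Mapping.lookup (r i))"
    and "\<And>i. i \<in> I \<Longrightarrow> coord_sum (r i) = 0"
  shows "\<exists>G. completely_wired G \<and> sandpile_graph G \<and> absolute_sink G \<and> verts G = V \<and>
    laplacian_lattice G = frag.span (r ` I)"
  using assms
proof (induction V I "\<lambda>i. Poly_Mapping.lookup (r i)" rule: glued.induct)
  case (single v)
  define G where "G = \<lparr>verts = {v}, wt = (\<lambda>_ _. 0), sink = v\<rparr>"
  have "sandpile_graph G" "absolute_sink G" and cw: "completely_wired G" and v: "verts G = {v}"
    unfolding sandpile_graph_def absolute_sink_def outdeg_def G_def
    by (auto simp: edges_def intro: completely_wired.single)
  moreover have "laplacian G (frag_of v) = 0"
    by (intro poly_mapping_eqI) (simp add: lookup_laplacian v, simp add: G_def outdeg_def)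
  ultimately show ?case
    by (intro exI[of _ G]) (auto simp: laplacian_lattice_eq_span)
next
  case (join V1 I1 V2 I2 i)
  obtain G1 where G1: "completely_wired G1" "sandpile_graph G1" "absolute_sink G1" "verts G1 = V1"
    "laplacian_lattice G1 = frag.span (r ` I1)"
    using join.hyps(2) join.prems by auto
  obtain G2 where G2: "completely_wired G2" "sandpile_graph G2" "absolute_sink G2" "verts G2 = V2"
    "laplacian_lattice G2 = frag.span (r ` I2)"
    using join.hyps(4) join.prems by auto
  have fin: "finite V1" "finite V2" using join.hyps glued_finite by blast+
  let ?s = "sink G1"
  have s: "?s \<in> V1" using G1 unfolding sandpile_graph_def by auto
  obtain c where c: "c \<in> frag.span (r ` I1)" "\<forall>v\<in>V1 - {?s}. Poly_Mapping.lookup c v > 0"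
    using glued_span_positive[OF join.hyps(1) s] by blast
  have ck: "Poly_Mapping.keys c \<subseteq> V1" using glued_span_keys[OF join.hyps(1) c(1)] .
  define N where "N = (\<Sum>v\<in>V1. \<bar>Poly_Mapping.lookup (r i) v\<bar>)"
  define d where "d = r i - frag_cmul N c"
  have d_out: "Poly_Mapping.lookup d v = Poly_Mapping.lookup (r i) v" if "v \<notin> V1" for v
    using ck that unfolding d_def by (auto simp: lookup_frag in_keys_iff)
  have dneg: "Poly_Mapping.lookup d v \<le> 0" if "v \<noteq> ?s" for v
  proof (cases "v \<in> V1")
    case True
    have "\<bar>Poly_Mapping.lookup (r i) v\<bar> \<le> N"
      unfolding N_def using True fin by (intro member_le_sum) auto
    moreover have "N * Poly_Mapping.lookup c v \<ge> N * 1"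
      using c True that by (intro mult_left_mono) (force, auto simp: N_def intro: sum_nonneg)
    ultimately show ?thesis unfolding d_def by (simp add: lookup_frag)
  next
    case False
    then show ?thesis using d_out join.hyps by (cases "v \<in> V2") auto
  qed
  have "coord_sum c = 0" using join.prems by (intro coord_sum_span[OF c(1)]) auto
  moreover have "coord_sum (r i) = 0" using join.prems by simp
  ultimately have dsum: "coord_sum d = 0" unfolding d_def by (simp add: coord_sum_diff coord_sum_cmul)
  have dk: "Poly_Mapping.keys d \<subseteq> V1 \<union> V2"
    using d_out join.hyps by (auto simp: in_keys_iff)
  have "restrict_frag V1 (r i) \<in> linear_system G1 (restrict_frag V1 d)"
  proof -
    have "restrict_frag V1 d - restrict_frag V1 (r i) = frag_cmul (- N) c"
      using ck fin by (intro poly_mapping_eqI) (auto simp: lookup_frag lookup_restrict_frag d_def in_keys_iff)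
    also have "\<dots> \<in> laplacian_lattice G1" using c G1 frag.span_scale by metis
    finally have "linearly_equivalent G1 (restrict_frag V1 d) (restrict_frag V1 (r i))"
      unfolding linearly_equivalent_def .
    moreover have "Poly_Mapping.keys (restrict_frag V1 (r i)) \<subseteq> V1"
      by (rule subsetI, rule ccontr) (simp add: lookup_restrict_frag[OF fin(1)] in_keys_iff)
    ultimately show ?thesis
      using join.hyps(6) fin G1(4) unfolding linear_system_def by (simp add: lookup_restrict_frag)
  qed
  then obtain G where G: "is_wiring G1 G2 G"
    "laplacian_lattice G = frag.span (insert d (laplacian_lattice G1 \<union> laplacian_lattice G2))"
    using wiring_exists[OF G1(2,3) G2(2,3), of d] G1 G2 join.hyps dk dsum dneg d_out
    by (metis Int_iff empty_iff)
  have "frag.span (insert d (frag.span (r ` I1) \<union> frag.span (r ` I2)))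
      = frag.span (insert (r i) (r ` I1 \<union> r ` I2))"
    unfolding frag.span_eq
  proof
    let ?R = "frag.span (insert (r i) (r ` I1 \<union> r ` I2))"
    have i1: "frag.span (r ` I1) \<subseteq> ?R" and "frag.span (r ` I2) \<subseteq> ?R" by (intro frag.span_mono; auto)+
    moreover have "d \<in> ?R"
      unfolding d_def using c i1 by (intro frag.span_diff frag.span_scale) (auto intro: frag.span_base)
    ultimately show "insert d (frag.span (r ` I1) \<union> frag.span (r ` I2)) \<subseteq> ?R" by auto
    let ?Q = "frag.span (insert d (frag.span (r ` I1) \<union> frag.span (r ` I2)))"
    have "d + frag_cmul N c \<in> ?Q"
      using c by (intro frag.span_add frag.span_scale) (auto intro: frag.span_base)
    then have "r i \<in> ?Q" unfolding d_def by simp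
    then show "insert (r i) (r ` I1 \<union> r ` I2) \<subseteq> ?Q"
      by (auto intro!: frag.span_base)
  qed
  then have "laplacian_lattice G = frag.span (r ` insert i (I1 \<union> I2))"
    using G(2) G1(5) G2(5) by (simp add: image_Un)
  moreover have "completely_wired G" using G1 G2 G by (auto intro: completely_wired.wired)
  ultimately show ?case using G(1) G1(4) G2(4) unfolding is_wiring_def by auto
qed

section \<open>Polynomials, exponent vectors and ideals\<close>

abbreviation mon :: "('v \<Rightarrow>\<^sub>0 nat) \<Rightarrow> 'v mpoly" where
  "mon u \<equiv> Poly_Mapping.single u 1"

lemma lookup_poly_scale: "Poly_Mapping.lookup (poly_scale c p) u = c * Poly_Mapping.lookup p u"
  unfolding poly_scale_def mult_map_scale_conv_mult[symmetric] by (simp add: map.rep_eq when_def)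

lemma poly_scale_single: "poly_scale c (Poly_Mapping.single u d) = Poly_Mapping.single u (c * d)"
  unfolding poly_scale_def mult_single by simp

lemma mpoly_sum_monomials: "p = (\<Sum>u\<in>Poly_Mapping.keys p. poly_scale (Poly_Mapping.lookup p u) (mon u))"
proof (rule poly_mapping_eqI)
  fix v
  have "Poly_Mapping.lookup (\<Sum>u\<in>Poly_Mapping.keys p. poly_scale (Poly_Mapping.lookup p u) (mon u)) v
     = (\<Sum>u\<in>Poly_Mapping.keys p. if u = v then Poly_Mapping.lookup p v else 0)"
    unfolding lookup_sum by (intro sum.cong) (auto simp: lookup_poly_scale lookup_single when_def)
  also have "\<dots> = Poly_Mapping.lookup p v" by (auto simp: in_keys_iff)
  finally show "Poly_Mapping.lookup p v
     = Poly_Mapping.lookup (\<Sum>u\<in>Poly_Mapping.keys p. poly_scale (Poly_Mapping.lookup p u) (mon u)) v" ..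
qed

lemma linear_times: "Vector_Spaces.linear poly_scale poly_scale ((*) (q :: 'v mpoly))"
  unfolding Vector_Spaces.linear_iff
  by (auto simp: distrib_left poly_scale_def mult.left_commute mpoly.vector_space_axioms)

lemma linear_span_image_subset:
  assumes "Vector_Spaces.linear poly_scale poly_scale h" "\<And>t. t \<in> T \<Longrightarrow> h t \<in> mpoly.span U"
    and "p \<in> mpoly.span T"
  shows "h p \<in> mpoly.span U"
proof -
  interpret Vector_Spaces.linear poly_scale poly_scale h by fact
  have "h ` mpoly.span T \<subseteq> mpoly.span U"
    unfolding span_image[symmetric] using assms(2) by (intro mpoly.span_minimal) auto
  then show ?thesis using assms(3) by auto
qed

abbreviation to_frag :: "('v \<Rightarrow>\<^sub>0 nat) \<Rightarrow> ('v \<Rightarrow>\<^sub>0 int)" where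
  "to_frag u \<equiv> Poly_Mapping.map int u"

lemma lookup_to_frag: "Poly_Mapping.lookup (to_frag u) v = int (Poly_Mapping.lookup u v)"
  by (simp add: map.rep_eq when_def)

lemma to_frag_add: "to_frag (u + v) = to_frag u + to_frag v"
  by (intro poly_mapping_eqI) (simp add: lookup_to_frag lookup_add)

lemma to_frag_single: "to_frag (Poly_Mapping.single v k) = frag_cmul (int k) (frag_of v)"
  by (intro poly_mapping_eqI) (simp add: lookup_to_frag lookup_single when_def)

lemma keys_to_frag: "Poly_Mapping.keys (to_frag u) = Poly_Mapping.keys u"
  by (auto simp: in_keys_iff lookup_to_frag)

lemma keys_add_nat: "Poly_Mapping.keys (u + v) = Poly_Mapping.keys u \<union> Poly_Mapping.keys (v :: 'v \<Rightarrow>\<^sub>0 nat)"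
  by (auto simp: in_keys_iff lookup_add)

lemma exp_deg_coord_sum: "int (exp_deg u) = coord_sum (to_frag u)"
  unfolding exp_deg_def coord_sum_def keys_to_frag by (simp add: lookup_to_frag)

lemma exp_deg_add: "exp_deg (u + v) = exp_deg u + exp_deg v"
  using coord_sum_add[of "to_frag u" "to_frag v"] unfolding to_frag_add[symmetric] exp_deg_coord_sum[symmetric]
  by linarith

lemma exp_deg_eq_0: "exp_deg u = 0 \<longleftrightarrow> u = 0"
  unfolding exp_deg_def by (auto simp: in_keys_iff) (metis keys_eq_empty ex_in_conv in_keys_iff)

lemma exp_deg_single [simp]: "exp_deg (Poly_Mapping.single v k) = k"
  unfolding exp_deg_def by simp

lemma frag_as_difference:
  fixes w :: "'v \<Rightarrow>\<^sub>0 int"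
  assumes "Poly_Mapping.keys w \<subseteq> V"
  obtains u v where "Poly_Mapping.keys u \<subseteq> V" "Poly_Mapping.keys v \<subseteq> V" "w = to_frag u - to_frag v"
proof
  let ?u = "Poly_Mapping.map nat w" and ?v = "Poly_Mapping.map nat (- w)"
  have l: "Poly_Mapping.lookup ?u x = nat (Poly_Mapping.lookup w x)"
    "Poly_Mapping.lookup ?v x = nat (- Poly_Mapping.lookup w x)" for x
    by (simp_all add: map.rep_eq when_def)
  show "Poly_Mapping.keys ?u \<subseteq> V" "Poly_Mapping.keys ?v \<subseteq> V"
    using assms l by (fastforce simp: in_keys_iff)+
  show "w = to_frag ?u - to_frag ?v"
    by (intro poly_mapping_eqI) (simp add: lookup_minus lookup_to_frag l)
qed

text \<open>For \<open>Q\<close> a class of monomials this is a linear functional, and a binomial is in its kernel if and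
  only if both or none of its monomials belong to the class.\<close>

definition coeff_sum :: "(('v \<Rightarrow>\<^sub>0 nat) \<Rightarrow> bool) \<Rightarrow> 'v mpoly \<Rightarrow> complex" where
  "coeff_sum Q p = (\<Sum>u\<in>Poly_Mapping.keys p. if Q u then Poly_Mapping.lookup p u else 0)"

lemma coeff_sum_superset:
  assumes "finite A" "Poly_Mapping.keys p \<subseteq> A"
  shows "coeff_sum Q p = (\<Sum>u\<in>A. if Q u then Poly_Mapping.lookup p u else 0)"
  unfolding coeff_sum_def using assms
  by (intro sum.mono_neutral_left) (auto simp: in_keys_iff)

lemma coeff_sum_add: "coeff_sum Q (p + q) = coeff_sum Q p + coeff_sum Q q"
proof -
  let ?A = "Poly_Mapping.keys p \<union> Poly_Mapping.keys q"
  have "coeff_sum Q (p + q) = (\<Sum>u\<in>?A. if Q u then Poly_Mapping.lookup (p + q) u else 0)"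
    using keys_add[of p q] by (intro coeff_sum_superset) auto
  also have "\<dots> = (\<Sum>u\<in>?A. if Q u then Poly_Mapping.lookup p u else 0)
      + (\<Sum>u\<in>?A. if Q u then Poly_Mapping.lookup q u else 0)"
    unfolding sum.distrib[symmetric] by (intro sum.cong) (auto simp: lookup_add)
  also have "\<dots> = coeff_sum Q p + coeff_sum Q q"
    by (auto intro!: arg_cong2[where f = "(+)"] coeff_sum_superset[symmetric])
  finally show ?thesis .
qed

lemma coeff_sum_diff: "coeff_sum Q (p - q) = coeff_sum Q p - coeff_sum Q q"
  using coeff_sum_add[of Q "p - q" q] by simp

lemma coeff_sum_scale: "coeff_sum Q (poly_scale c p) = c * coeff_sum Q p"
proof -
  have "coeff_sum Q (poly_scale c p)
      = (\<Sum>u\<in>Poly_Mapping.keys p. if Q u then Poly_Mapping.lookup (poly_scale c p) u else 0)"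
    by (intro coeff_sum_superset) (auto simp: in_keys_iff lookup_poly_scale)
  then show ?thesis unfolding coeff_sum_def sum_distrib_left
    by (auto simp: lookup_poly_scale intro!: sum.cong)
qed

lemma coeff_sum_mon: "coeff_sum Q (mon u) = (if Q u then 1 else 0)"
  unfolding coeff_sum_def by simp

lemma coeff_sum_span_0:
  assumes "p \<in> mpoly.span T" "\<And>t. t \<in> T \<Longrightarrow> coeff_sum Q t = 0"
  shows "coeff_sum Q p = 0"
  using assms(1)
proof (induction rule: mpoly.span_induct_alt)
  case base then show ?case by (simp add: coeff_sum_def)
next
  case (step c t p)
  then show ?case using assms(2) by (simp add: coeff_sum_add coeff_sum_scale)
qed

definition part :: "(('v \<Rightarrow>\<^sub>0 nat) \<Rightarrow> bool) \<Rightarrow> 'v mpoly \<Rightarrow> 'v mpoly" where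
  "part Q p = Abs_poly_mapping (\<lambda>u. if Q u then Poly_Mapping.lookup p u else 0)"

lemma lookup_part: "Poly_Mapping.lookup (part Q p) u = (if Q u then Poly_Mapping.lookup p u else 0)"
proof -
  have "finite {u. (if Q u then Poly_Mapping.lookup p u else 0) \<noteq> 0}"
    by (rule finite_subset[OF _ finite_keys[of p]]) (auto simp: in_keys_iff)
  then show ?thesis unfolding part_def by simp
qed

lemma part_add: "part Q (p + q) = part Q p + part Q q"
  and part_diff: "part Q (p - q) = part Q p - part Q q"
  and part_scale: "part Q (poly_scale c p) = poly_scale c (part Q p)"
  and part_zero: "part Q 0 = 0"
  by (intro poly_mapping_eqI; simp add: lookup_part lookup_add lookup_minus lookup_poly_scale)+

lemma part_mon: "part Q (mon u) = (if Q u then mon u else 0)"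
  by (intro poly_mapping_eqI) (auto simp: lookup_part lookup_single when_def)

lemma part_eq_self: "(\<And>u. u \<in> Poly_Mapping.keys p \<Longrightarrow> Q u) \<Longrightarrow> part Q p = p"
  by (intro poly_mapping_eqI) (metis lookup_part in_keys_iff)

lemma part_eq_0: "(\<And>u. u \<in> Poly_Mapping.keys p \<Longrightarrow> \<not> Q u) \<Longrightarrow> part Q p = 0"
  by (intro poly_mapping_eqI) (metis lookup_part in_keys_iff lookup_zero)

text \<open>Linear combinations of homogeneous elements decompose degree by degree: taking a component only
  discards generators.\<close>

lemma part_in_span:
  assumes "p \<in> mpoly.span T" "\<And>t. t \<in> T \<Longrightarrow> part Q t = t \<or> part Q t = 0"
  shows "part Q p \<in> mpoly.span {t \<in> T. part Q t = t}"
  using assms(1)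
proof (induction rule: mpoly.span_induct_alt)
  case base then show ?case by (simp add: part_zero mpoly.span_zero)
next
  case (step c t p)
  then show ?case using assms(2)[of t]
    by (auto simp: part_add part_scale intro!: mpoly.span_add mpoly.span_scale
        intro: mpoly.span_base mpoly.span_zero)
qed

lemma poly_ring_simps [simp]:
  "x \<oplus>\<^bsub>poly_ring S\<^esub> y = x + y" "x \<otimes>\<^bsub>poly_ring S\<^esub> y = x * y"
  "\<zero>\<^bsub>poly_ring S\<^esub> = 0" "\<one>\<^bsub>poly_ring S\<^esub> = 1"
  by (simp_all add: poly_ring_def)

lemma in_poly_ring: "p \<in> carrier (poly_ring S) \<longleftrightarrow> (\<forall>u\<in>Poly_Mapping.keys p. Poly_Mapping.keys u \<subseteq> S)"
  by (simp add: poly_ring_def)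

lemma poly_ring_ring: "ring (poly_ring S)"
  using poly_ring_cring by (rule cring.axioms)

lemma subspace_poly_ring: "mpoly.subspace (carrier (poly_ring S))"
proof (rule mpoly.subspaceI)
  fix x y :: "'a mpoly" and c :: complex
  assume x: "x \<in> carrier (poly_ring S)"
  show "x + y \<in> carrier (poly_ring S)" if "y \<in> carrier (poly_ring S)"
    using x that keys_add[of x y] unfolding in_poly_ring by blast
  show "poly_scale c x \<in> carrier (poly_ring S)"
    using x unfolding in_poly_ring by (auto simp: in_keys_iff lookup_poly_scale)
qed (simp add: in_poly_ring)

lemma ideal_subspace:
  assumes "ideal J (poly_ring S)"
  shows "mpoly.subspace J"
proof -
  interpret ideal J "poly_ring S" by fact
  show ?thesis
  proof (rule mpoly.subspaceI)
    show "0 \<in> J" using additive_subgroup.zero_closed[OF ideal.axioms(1)[OF assms]] by simp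
    show "x + y \<in> J" if "x \<in> J" "y \<in> J" for x y
      using additive_subgroup.a_closed[OF ideal.axioms(1)[OF assms] that] by simp
    show "poly_scale c x \<in> J" if "x \<in> J" for c x
    proof -
      have "Poly_Mapping.single 0 c \<in> carrier (poly_ring S)" by (auto simp: in_poly_ring)
      from I_l_closed[OF that this] show ?thesis by (simp add: poly_scale_def)
    qed
  qed
qed

text \<open>Lets ideals be studied as spans, where linear functionals and projections can be evaluated on
  generators.\<close>

lemma ideal_span:
  assumes car: "T \<subseteq> carrier (poly_ring S)"
    and mult: "\<And>t u. t \<in> T \<Longrightarrow> Poly_Mapping.keys u \<subseteq> S \<Longrightarrow> mon u * t \<in> mpoly.span T"
  shows "ideal (mpoly.span T) (poly_ring S)"
proof (rule idealI[OF poly_ring_ring])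
  have sub: "mpoly.span T \<subseteq> carrier (poly_ring S)"
    using car subspace_poly_ring by (rule mpoly.span_minimal)
  interpret R: cring "poly_ring S" by (rule poly_ring_cring)
  show "subgroup (mpoly.span T) (add_monoid (poly_ring S))"
  proof (rule subgroup.intro)
    show "inv\<^bsub>add_monoid (poly_ring S)\<^esub> x \<in> mpoly.span T" if x: "x \<in> mpoly.span T" for x
    proof -
      have "\<ominus>\<^bsub>poly_ring S\<^esub> x = - x"
        using x sub mpoly.span_neg[OF x] by (intro R.minus_equality) auto
      then show ?thesis using mpoly.span_neg[OF x] by (simp add: a_inv_def)
    qed
  qed (use sub in \<open>auto intro: mpoly.span_add mpoly.span_zero\<close>)
  have l: "x * a \<in> mpoly.span T" if a: "a \<in> mpoly.span T" and x: "x \<in> carrier (poly_ring S)" for a x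
  proof -
    have "(\<Sum>u\<in>Poly_Mapping.keys x. poly_scale (Poly_Mapping.lookup x u) (mon u * a)) \<in> mpoly.span T"
    proof (intro mpoly.span_sum mpoly.span_scale)
      fix u assume "u \<in> Poly_Mapping.keys x"
      then have "Poly_Mapping.keys u \<subseteq> S" using x unfolding in_poly_ring by blast
      then show "mon u * a \<in> mpoly.span T"
        by (intro linear_span_image_subset[OF linear_times _ a] mult)
    qed
    also have "(\<Sum>u\<in>Poly_Mapping.keys x. poly_scale (Poly_Mapping.lookup x u) (mon u * a))
       = (\<Sum>u\<in>Poly_Mapping.keys x. poly_scale (Poly_Mapping.lookup x u) (mon u)) * a"
      by (simp add: sum_distrib_right poly_scale_def mult.assoc)
    also have "\<dots> = x * a" using mpoly_sum_monomials[of x] by simp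
    finally show ?thesis .
  qed
  show "x \<otimes>\<^bsub>poly_ring S\<^esub> a \<in> mpoly.span T"
    if "a \<in> mpoly.span T" "x \<in> carrier (poly_ring S)" for a x using l[OF that] by simp
  show "a \<otimes>\<^bsub>poly_ring S\<^esub> x \<in> mpoly.span T"
    if "a \<in> mpoly.span T" "x \<in> carrier (poly_ring S)" for a x using l[OF that] by (simp add: mult.commute)
qed

lemma genideal_subset_span:
  fixes S :: "'v set"
  assumes F: "F \<subseteq> carrier (poly_ring S)"
  shows "genideal (poly_ring S) F \<subseteq> mpoly.span {mon u * f | u f. Poly_Mapping.keys u \<subseteq> S \<and> f \<in> F}"
    (is "_ \<subseteq> mpoly.span ?T")
proof -
  interpret R: cring "poly_ring S" by (rule poly_ring_cring)
  have "ideal (mpoly.span ?T) (poly_ring S)"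
  proof (rule ideal_span)
    show "?T \<subseteq> carrier (poly_ring S)"
    proof clarify
      fix u :: "'v \<Rightarrow>\<^sub>0 nat" and f assume u: "Poly_Mapping.keys u \<subseteq> S" and f: "f \<in> F"
      have "mon u \<in> carrier (poly_ring S)" using u by (auto simp: in_poly_ring)
      moreover have "f \<in> carrier (poly_ring S)" using f F by blast
      ultimately show "mon u * f \<in> carrier (poly_ring S)" using R.m_closed by fastforce
    qed
    fix t and u :: "'v \<Rightarrow>\<^sub>0 nat" assume "t \<in> ?T" and u: "Poly_Mapping.keys u \<subseteq> S"
    then obtain v f where t: "t = mon v * f" "Poly_Mapping.keys v \<subseteq> S" "f \<in> F" by blast
    have "mon u * t = mon (u + v) * f" unfolding t(1) by (simp add: mult_single mult.assoc[symmetric])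
    then show "mon u * t \<in> mpoly.span ?T"
      using t u by (intro mpoly.span_base) (auto simp: keys_add_nat intro!: exI[of _ "u + v"])
  qed
  moreover have "F \<subseteq> mpoly.span ?T"
  proof
    fix f assume "f \<in> F"
    then have "mon 0 * f \<in> ?T" by (intro CollectI exI[of _ 0] exI[of _ f]) auto
    then have "f \<in> ?T" unfolding single_one mult_1_left .
    then show "f \<in> mpoly.span ?T" by (rule mpoly.span_base)
  qed
  ultimately show ?thesis by (rule R.genideal_minimal)
qed

definition lattice_binomials :: "'v set \<Rightarrow> ('v \<Rightarrow>\<^sub>0 int) set \<Rightarrow> 'v mpoly set" where
  "lattice_binomials V L = {mon u - mon v | u v. Poly_Mapping.keys u \<subseteq> V \<and> Poly_Mapping.keys v \<subseteq> V \<and>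
       to_frag u - to_frag v \<in> L}"

lemma lattice_ideal_eq: "lattice_ideal V L = mpoly.span (lattice_binomials V L)"
  unfolding lattice_ideal_def lattice_binomials_def ..

lemma lattice_binomialsI:
  "Poly_Mapping.keys u \<subseteq> V \<Longrightarrow> Poly_Mapping.keys v \<subseteq> V \<Longrightarrow> to_frag u - to_frag v \<in> L \<Longrightarrow>
    mon u - mon v \<in> lattice_binomials V L"
  unfolding lattice_binomials_def by blast

lemma lattice_binomials_times:
  assumes "p \<in> lattice_binomials V L" "Poly_Mapping.keys t \<subseteq> V"
  shows "mon t * p \<in> lattice_binomials V L"
proof -
  obtain u v where p: "p = mon u - mon v" "Poly_Mapping.keys u \<subseteq> V" "Poly_Mapping.keys v \<subseteq> V"
    "to_frag u - to_frag v \<in> L"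
    using assms unfolding lattice_binomials_def by blast
  have "mon t * p = mon (t + u) - mon (t + v)"
    unfolding p(1) by (simp add: right_diff_distrib mult_single)
  moreover have "to_frag (t + u) - to_frag (t + v) = to_frag u - to_frag v"
    by (simp add: to_frag_add)
  ultimately show ?thesis
    using p assms by (auto intro!: lattice_binomialsI simp: keys_add_nat)
qed

lemma lattice_ideal_ideal: "ideal (lattice_ideal V L) (poly_ring V)"
  unfolding lattice_ideal_eq
proof (rule ideal_span)
  show "lattice_binomials V L \<subseteq> carrier (poly_ring V)"
  proof
    fix p assume "p \<in> lattice_binomials V L"
    then obtain u v where "p = mon u - mon v" "Poly_Mapping.keys u \<subseteq> V" "Poly_Mapping.keys v \<subseteq> V"
      unfolding lattice_binomials_def by blast
    moreover from this have "mon u \<in> carrier (poly_ring V)" "mon v \<in> carrier (poly_ring V)"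
      by (auto simp: in_poly_ring)
    ultimately show "p \<in> carrier (poly_ring V)"
      using mpoly.subspace_diff[OF subspace_poly_ring] by blast
  qed
qed (auto intro: mpoly.span_base lattice_binomials_times)

lemma homogeneous_part:
  assumes "homogeneous p"
  shows "part (\<lambda>u. exp_deg u = d) p = p \<or> part (\<lambda>u. exp_deg u = d) p = 0"
proof -
  obtain e where e: "\<And>u. u \<in> Poly_Mapping.keys p \<Longrightarrow> exp_deg u = e"
    using assms unfolding homogeneous_def by blast
  show ?thesis
    using part_eq_self[of p "\<lambda>u. exp_deg u = d"] part_eq_0[of p "\<lambda>u. exp_deg u = d"] e
    by (cases "e = d") auto
qed

lemma homogeneous_mon_times:
  assumes "homogeneous p"
  shows "homogeneous (mon t * p)"
proof -
  obtain d where d: "\<forall>u\<in>Poly_Mapping.keys p. exp_deg u = d"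
    using assms unfolding homogeneous_def by blast
  have "exp_deg u = exp_deg t + d" if "u \<in> Poly_Mapping.keys (mon t * p)" for u
    using that d keys_mult[of "mon t" p] by (auto simp: exp_deg_add)
  then show ?thesis unfolding homogeneous_def by blast
qed

text \<open>If the two monomials of a binomial in the ideal had different degrees, each of them would be a
  homogeneous component of it and hence lie in the ideal. But the sum of the coefficients vanishes on
  every lattice ideal.\<close>

lemma lattice_coord_sum_zero:
  fixes V :: "'v set"
  assumes gen: "lattice_ideal V L = genideal (poly_ring V) F" "F \<subseteq> carrier (poly_ring V)"
    and hom: "\<And>f. f \<in> F \<Longrightarrow> homogeneous f"
    and w: "w \<in> L" "Poly_Mapping.keys w \<subseteq> V"
  shows "coord_sum w = 0"
proof -
  interpret R: cring "poly_ring V" by (rule poly_ring_cring)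
  obtain u v where uv: "Poly_Mapping.keys u \<subseteq> V" "Poly_Mapping.keys v \<subseteq> V" "w = to_frag u - to_frag v"
    using frag_as_difference[OF w(2)] .
  let ?T = "{mon t * f | t f. Poly_Mapping.keys t \<subseteq> V \<and> f \<in> F}"
  let ?Q = "\<lambda>x. exp_deg x = exp_deg u"
  have "exp_deg u = exp_deg v"
  proof (rule ccontr)
    assume ne: "exp_deg u \<noteq> exp_deg v"
    have "mon u - mon v \<in> lattice_ideal V L"
      unfolding lattice_ideal_eq using uv w by (intro mpoly.span_base lattice_binomialsI) auto
    then have "mon u - mon v \<in> mpoly.span ?T"
      using genideal_subset_span[OF gen(2)] gen(1) by blast
    then have "part ?Q (mon u - mon v) \<in> mpoly.span {t \<in> ?T. part ?Q t = t}"
      using hom by (intro part_in_span) (auto intro!: homogeneous_part homogeneous_mon_times)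
    also have "part ?Q (mon u - mon v) = mon u" using ne by (simp add: part_diff part_mon)
    also have "mpoly.span {t \<in> ?T. part ?Q t = t} \<subseteq> mpoly.span ?T" by (intro mpoly.span_mono) auto
    also have "mpoly.span ?T \<subseteq> lattice_ideal V L"
    proof (rule mpoly.span_minimal)
      show "mpoly.subspace (lattice_ideal V L)" by (rule ideal_subspace[OF lattice_ideal_ideal])
      show "?T \<subseteq> lattice_ideal V L"
      proof clarify
        fix t :: "'v \<Rightarrow>\<^sub>0 nat" and f assume t: "Poly_Mapping.keys t \<subseteq> V" "f \<in> F"
        have "f \<in> lattice_ideal V L" using R.genideal_self[OF gen(2)] gen(1) t by auto
        moreover have "mon t \<in> carrier (poly_ring V)" using t by (auto simp: in_poly_ring)
        ultimately show "mon t * f \<in> lattice_ideal V L"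
          using ideal.I_l_closed[OF lattice_ideal_ideal] by fastforce
      qed
    qed
    finally have "coeff_sum (\<lambda>_. True) (mon u) = 0"
      unfolding lattice_ideal_eq
      by (rule coeff_sum_span_0) (auto simp: lattice_binomials_def coeff_sum_diff coeff_sum_mon)
    then show False by (simp add: coeff_sum_mon)
  qed
  then show ?thesis
    using exp_deg_coord_sum[of u] exp_deg_coord_sum[of v] unfolding uv(3) coord_sum_diff by simp
qed

section \<open>Binomial generators of a complete intersection\<close>

text \<open>The elements of \<open>B\<close> are independent modulo the span of \<open>T\<close>, and those of \<open>F\<close> span them there.
  Instead of passing to the quotient, apply a linear map that kills \<open>T\<close> and fixes \<open>B\<close>.\<close>

lemma card_independent_modulo:
  assumes ind: "mpoly.independent (T \<union> B)" "T \<inter> B = {}" and fin: "finite F"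
    and sp: "B \<subseteq> mpoly.span (T \<union> F)"
  shows "finite B \<and> card B \<le> card F"
proof -
  interpret P: vector_space_pair poly_scale poly_scale ..
  obtain g where g: "Vector_Spaces.linear poly_scale poly_scale g"
    "\<forall>x\<in>T \<union> B. g x = (if x \<in> T then 0 else x)"
    using P.linear_independent_extend[OF ind(1), of "\<lambda>x. if x \<in> T then 0 else x"] by blast
  have "B \<subseteq> mpoly.span (g ` F)"
  proof
    fix b assume b: "b \<in> B"
    have "g b \<in> mpoly.span (g ` F)"
    proof (rule linear_span_image_subset[OF g(1)])
      show "b \<in> mpoly.span (T \<union> F)" using b sp by blast
      show "g t \<in> mpoly.span (g ` F)" if "t \<in> T \<union> F" for t
        using that g(2) by (auto intro: mpoly.span_base mpoly.span_zero)
    qed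
    moreover have "g b = b" using g(2) b ind(2) by auto
    ultimately show "b \<in> mpoly.span (g ` F)" by simp
  qed
  moreover have "mpoly.independent B" using ind(1) by (rule mpoly.independent_mono) auto
  ultimately have "finite B \<and> card B \<le> card (g ` F)"
    using fin by (intro mpoly.independent_span_bound) auto
  then show ?thesis using card_image_le[OF fin, of g] by linarith
qed

text \<open>A graded Nakayama argument. Let \<open>M\<close> be the ideal generated by the variables. For \<open>I\<close> the lattice
  ideal, \<open>MI\<close> is spanned by the set \<open>S0\<close> of binomials whose two monomials share a variable (and 0),
  and \<open>B\<close> consists of binomials that form a basis of \<open>I\<close> modulo \<open>MI\<close>. The generators \<open>F\<close> span \<open>I\<close>
  modulo \<open>MI\<close>, which bounds the size of \<open>B\<close>, and elements of \<open>B\<close> lie outside \<open>MI\<close>, which makes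
  their monomials coprime. Finally \<open>B\<close> generates \<open>I\<close> by induction on the degree: up to elements of
  \<open>B\<close>, a binomial is a combination of multiples of binomials of smaller degree.\<close>

lemma binomial_generators:
  fixes V :: "'v set"
  assumes gen: "lattice_ideal V L = genideal (poly_ring V) F" "F \<subseteq> carrier (poly_ring V)"
    and fin: "finite F" and sum0: "\<And>w. w \<in> L \<Longrightarrow> coord_sum w = 0"
  obtains B where "finite B" "card B \<le> card F"
    "\<And>b. b \<in> B \<Longrightarrow> \<exists>u v. b = mon u - mon v \<and> Poly_Mapping.keys u \<subseteq> V \<and> Poly_Mapping.keys v \<subseteq> V \<and>
       to_frag u - to_frag v \<in> L \<and> u \<noteq> v \<and> Poly_Mapping.keys u \<inter> Poly_Mapping.keys v = {}"
    "lattice_binomials V L \<subseteq> mpoly.span {mon t * b | t b. Poly_Mapping.keys t \<subseteq> V \<and> b \<in> B}"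
proof -
  interpret R: cring "poly_ring V" by (rule poly_ring_cring)
  let ?S = "lattice_binomials V L"
  define S0 where "S0 = {mon t * p | t p. Poly_Mapping.keys t \<subseteq> V \<and> t \<noteq> 0 \<and> p \<in> ?S}"
  have S0S: "S0 \<subseteq> ?S" unfolding S0_def by (auto intro: lattice_binomials_times)
  obtain T where T: "T \<subseteq> S0" "mpoly.independent T" "S0 \<subseteq> mpoly.span T"
    using mpoly.maximal_independent_subset by blast
  \<comment> \<open>\<open>T\<close> is a basis of \<open>MI\<close>, and it is completed to a basis \<open>E\<close> of \<open>I\<close> by binomials\<close>
  obtain E where E: "T \<subseteq> E" "E \<subseteq> ?S" "mpoly.independent E" "?S \<subseteq> mpoly.span E"
    using mpoly.maximal_independent_subset_extend[of T ?S] T S0S by blast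
  define B where "B = E - T"
  have TB: "T \<union> B = E" "T \<inter> B = {}" using E unfolding B_def by auto
  have BS: "B \<subseteq> ?S" using E unfolding B_def by auto
  have FS: "F \<subseteq> mpoly.span ?S" using R.genideal_self[OF gen(2)] gen(1) lattice_ideal_eq by metis
  have "finite B \<and> card B \<le> card F"
  proof (rule card_independent_modulo[OF _ TB(2) fin])
    show "mpoly.independent (T \<union> B)" using E TB by simp
    have "mpoly.span {mon t * f | t f. Poly_Mapping.keys t \<subseteq> V \<and> f \<in> F} \<subseteq> mpoly.span (T \<union> F)"
    proof (rule mpoly.span_minimal, clarify)
      fix t :: "'v \<Rightarrow>\<^sub>0 nat" and f assume t: "Poly_Mapping.keys t \<subseteq> V" and f: "f \<in> F"
      show "mon t * f \<in> mpoly.span (T \<union> F)"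
      proof (cases "t = 0")
        case True then show ?thesis using f by (simp add: mpoly.span_base)
      next
        case False
        have "mon t * f \<in> mpoly.span S0"
        proof (rule linear_span_image_subset[OF linear_times])
          show "f \<in> mpoly.span ?S" using f FS by blast
          show "mon t * p \<in> mpoly.span S0" if "p \<in> ?S" for p
            using that t False unfolding S0_def by (intro mpoly.span_base) blast
        qed
        also have "mpoly.span S0 \<subseteq> mpoly.span T" using T(3) by (rule mpoly.span_minimal) simp
        also have "mpoly.span T \<subseteq> mpoly.span (T \<union> F)" by (intro mpoly.span_mono) auto
        finally show ?thesis .
      qed
    qed simp
    moreover have "B \<subseteq> lattice_ideal V L" using BS mpoly.span_superset unfolding lattice_ideal_eq by blast
    ultimately show "B \<subseteq> mpoly.span (T \<union> F)" using gen(1) genideal_subset_span[OF gen(2)] by blast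
  qed
  moreover have "\<exists>u v. b = mon u - mon v \<and> Poly_Mapping.keys u \<subseteq> V \<and> Poly_Mapping.keys v \<subseteq> V \<and>
       to_frag u - to_frag v \<in> L \<and> u \<noteq> v \<and> Poly_Mapping.keys u \<inter> Poly_Mapping.keys v = {}" if b: "b \<in> B" for b
  proof -
    obtain u v where uv: "b = mon u - mon v" "Poly_Mapping.keys u \<subseteq> V" "Poly_Mapping.keys v \<subseteq> V"
       "to_frag u - to_frag v \<in> L"
      using b BS unfolding lattice_binomials_def by blast
    have "b \<in> E" using b unfolding B_def by simp
    have "b \<noteq> 0" using E(3) \<open>b \<in> E\<close> mpoly.dependent_zero by metis
    then have "u \<noteq> v" using uv by auto
    have "b \<notin> mpoly.span T"
    proof
      assume "b \<in> mpoly.span T"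
      then have "b \<in> mpoly.span (E - {b})"
        using mpoly.span_mono[of T "E - {b}"] E(1) b unfolding B_def by blast
      then show False using E(3) \<open>b \<in> E\<close> unfolding mpoly.dependent_def by blast
    qed
    then have bS0: "b \<notin> S0" using T(3) by blast
    have "Poly_Mapping.keys u \<inter> Poly_Mapping.keys v = {}"
    proof (rule ccontr)
      assume "\<not> ?thesis"
      then obtain i where i: "i \<in> Poly_Mapping.keys u" "i \<in> Poly_Mapping.keys v" by blast
      let ?e = "Poly_Mapping.single i (1::nat)"
      have split: "u = ?e + (u - ?e)" "v = ?e + (v - ?e)"
        using i by (auto intro!: poly_mapping_eqI simp: lookup_add lookup_minus lookup_single when_def in_keys_iff)
      have "b = mon ?e * (mon (u - ?e) - mon (v - ?e))"
        unfolding uv(1) by (subst split(1), subst split(2)) (simp add: right_diff_distrib mult_single)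
      moreover have "mon (u - ?e) - mon (v - ?e) \<in> ?S"
      proof (rule lattice_binomialsI)
        show "Poly_Mapping.keys (u - ?e) \<subseteq> V" "Poly_Mapping.keys (v - ?e) \<subseteq> V"
          using uv split by (metis keys_add_nat le_sup_iff)+
        have "to_frag u - to_frag v = to_frag (u - ?e) - to_frag (v - ?e)"
          by (subst split(1), subst split(2)) (simp add: to_frag_add)
        then show "to_frag (u - ?e) - to_frag (v - ?e) \<in> L" using uv by simp
      qed
      moreover have "Poly_Mapping.keys ?e \<subseteq> V" using i uv by auto
      moreover have "?e \<noteq> 0" by (metis lookup_single_eq lookup_zero one_neq_zero)
      ultimately have "b \<in> S0" unfolding S0_def by blast
      then show False using bS0 by blast
    qed
    with uv \<open>u \<noteq> v\<close> show ?thesis by blast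
  qed
  moreover have "?S \<subseteq> mpoly.span {mon t * b | t b. Poly_Mapping.keys t \<subseteq> V \<and> b \<in> B}"
    (is "_ \<subseteq> mpoly.span ?J")
  proof -
    have deg: "exp_deg u = exp_deg v" if "to_frag u - to_frag v \<in> L" for u v :: "'v \<Rightarrow>\<^sub>0 nat"
      using sum0[OF that] exp_deg_coord_sum[of u] exp_deg_coord_sum[of v] unfolding coord_sum_diff by simp
    have "mon u - mon v \<in> mpoly.span ?J"
      if "Poly_Mapping.keys u \<subseteq> V" "Poly_Mapping.keys v \<subseteq> V" "to_frag u - to_frag v \<in> L" for u v
      using that
    proof (induction "exp_deg u" arbitrary: u v rule: less_induct)
      case less
      let ?Q = "\<lambda>x. exp_deg x = exp_deg u"
      have hom: "part ?Q p = p \<or> part ?Q p = 0" if pS: "p \<in> ?S" for p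
      proof (rule homogeneous_part)
        obtain x y where "p = mon x - mon y" "to_frag x - to_frag y \<in> L"
          using pS unfolding lattice_binomials_def by blast
        then show "homogeneous p"
          using deg[of x y] keys_diff[of "mon x" "mon y"] unfolding homogeneous_def
          by (intro exI[of _ "exp_deg x"]) auto
      qed
      have "mon u - mon v \<in> mpoly.span E"
        using less.prems E(4) by (blast intro: lattice_binomialsI)
      also have "mpoly.span E \<subseteq> mpoly.span (S0 \<union> B)"
        using T(1) TB by (intro mpoly.span_mono) auto
      finally have "part ?Q (mon u - mon v) \<in> mpoly.span {t \<in> S0 \<union> B. part ?Q t = t}"
        using hom S0S BS by (intro part_in_span) auto
      also have "part ?Q (mon u - mon v) = mon u - mon v"
        using deg[OF less.prems(3)] by (simp add: part_diff part_mon)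
      also have "mpoly.span {t \<in> S0 \<union> B. part ?Q t = t} \<subseteq> mpoly.span ?J"
      proof (rule mpoly.span_minimal, clarify)
        fix p assume p: "p \<in> S0 \<union> B" "part ?Q p = p"
        show "p \<in> mpoly.span ?J"
        proof (cases "p \<in> B")
          case True
          then have "mon 0 * p \<in> ?J" by (intro CollectI exI[of _ 0] exI[of _ p]) auto
          then have "p \<in> ?J" unfolding single_one mult_1_left .
          then show ?thesis by (rule mpoly.span_base)
        next
          case False
          then obtain t q where q: "p = mon t * q" "Poly_Mapping.keys t \<subseteq> V" "t \<noteq> 0" "q \<in> ?S"
            using p unfolding S0_def by blast
          obtain x y where xy: "q = mon x - mon y" "Poly_Mapping.keys x \<subseteq> V" "Poly_Mapping.keys y \<subseteq> V"
            "to_frag x - to_frag y \<in> L"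
            using q(4) unfolding lattice_binomials_def by blast
          show ?thesis
          proof (cases "x = y")
            case True then show ?thesis using q xy by (simp add: mpoly.span_zero)
          next
            case False
            have px: "p = mon (t + x) - mon (t + y)"
              unfolding q(1) xy(1) by (simp add: right_diff_distrib mult_single)
            have "exp_deg (t + x) = exp_deg u"
            proof (rule ccontr)
              assume "exp_deg (t + x) \<noteq> exp_deg u"
              then have "Poly_Mapping.lookup p (t + x) = 0"
                using arg_cong[OF p(2), of "\<lambda>q. Poly_Mapping.lookup q (t + x)"]
                by (simp add: lookup_part)
              then show False using False unfolding px by (simp add: lookup_minus lookup_single when_def)
            qed
            moreover have "exp_deg t \<noteq> 0" using q(3) exp_deg_eq_0 by blast
            ultimately have "exp_deg x < exp_deg u" by (simp add: exp_deg_add)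
            then have "q \<in> mpoly.span ?J" unfolding xy(1) using xy by (intro less.hyps) auto
            then show ?thesis unfolding q(1)
            proof (rule linear_span_image_subset[OF linear_times, rotated])
              fix j assume "j \<in> ?J"
              then obtain z b where j: "j = mon z * b" "Poly_Mapping.keys z \<subseteq> V" "b \<in> B" by blast
              have "mon t * j = mon (t + z) * b" unfolding j(1) by (simp add: mult_single mult.assoc[symmetric])
              then show "mon t * j \<in> mpoly.span ?J"
                using j q by (intro mpoly.span_base) (auto simp: keys_add_nat intro!: exI[of _ "t + z"])
            qed
          qed
        qed
      qed simp
      finally show ?case .
    qed
    then show ?thesis unfolding lattice_binomials_def by blast
  qed
  ultimately show ?thesis using that by blast
qed

text \<open>A binomial in the ideal generated by \<open>B\<close> has monomials that are connected by steps
  \<open>t + \<alpha> b \<leftrightarrow> t + \<beta> b\<close>. Invariants of such steps are detected by the functional \<open>coeff_sum Q\<close>.\<close>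

lemma binomial_span_invariant:
  assumes "mon x - mon y \<in> mpoly.span {mon t * b | t b. Poly_Mapping.keys t \<subseteq> V \<and> b \<in> B}"
    and b: "\<And>b. b \<in> B \<Longrightarrow> b = mon (\<alpha> b) - mon (\<beta> b)"
    and Q: "\<And>t b. b \<in> B \<Longrightarrow> Q (t + \<alpha> b) \<longleftrightarrow> Q (t + \<beta> b)"
  shows "Q x \<longleftrightarrow> Q y"
proof -
  have "coeff_sum Q (mon t * b) = 0" if "b \<in> B" for t b
  proof -
    have "mon t * b = mon (t + \<alpha> b) - mon (t + \<beta> b)"
      by (subst b[OF that]) (simp add: right_diff_distrib mult_single)
    then show ?thesis using Q[OF that, of t] by (simp add: coeff_sum_diff coeff_sum_mon)
  qed
  then have "coeff_sum Q (mon x - mon y) = 0"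
    by (intro coeff_sum_span_0[OF assms(1)]) auto
  then show ?thesis by (simp add: coeff_sum_diff coeff_sum_mon split: if_splits)
qed

text \<open>The rows are the exponent differences of the binomial generators. Two invariants are used. The
  coset of an exponent vector modulo the span of the rows shows that the rows generate \<open>L\<close>. The
  property of not involving the variables in \<open>Z\<close> (equivalently, of not vanishing at the indicator
  vector of \<open>V - Z\<close>) distinguishes \<open>x\<^sub>l\<^sup>m\<close> from \<open>x\<^sub>j\<^sup>m\<close> for \<open>j\<close> in \<open>Z\<close> and \<open>l\<close> outside, so some generator
  does not respect it: the corresponding row is nonzero of one sign on \<open>Z\<close>.\<close>

theorem complete_intersection_glued:
  fixes V :: "'v set"
  assumes V: "finite V"
    and L: "frag.subspace L" "\<And>w. w \<in> L \<Longrightarrow> Poly_Mapping.keys w \<subseteq> V" "\<And>w. w \<in> L \<Longrightarrow> coord_sum w = 0"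
    and tors: "\<And>j l. j \<in> V \<Longrightarrow> l \<in> V \<Longrightarrow> \<exists>m>0. frag_cmul (int m) (frag_of j - frag_of l) \<in> L"
    and gen: "lattice_ideal V L = genideal (poly_ring V) F" "F \<subseteq> carrier (poly_ring V)"
    and F: "finite F" "card F < card V"
  shows "\<exists>(B :: 'v mpoly set) r. glued V B (\<lambda>b. Poly_Mapping.lookup (r b)) \<and> L = frag.span (r ` B)"
proof -
  obtain B where B: "finite B" "card B \<le> card F"
    "\<And>b. b \<in> B \<Longrightarrow> \<exists>u v. b = mon u - mon v \<and> Poly_Mapping.keys u \<subseteq> V \<and> Poly_Mapping.keys v \<subseteq> V \<and>
       to_frag u - to_frag v \<in> L \<and> u \<noteq> v \<and> Poly_Mapping.keys u \<inter> Poly_Mapping.keys v = {}"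
    and S: "lattice_binomials V L \<subseteq> mpoly.span {mon t * b | t b. Poly_Mapping.keys t \<subseteq> V \<and> b \<in> B}"
    using binomial_generators[OF gen F(1) L(3)] by blast
  define P where "P b u v \<longleftrightarrow> b = mon u - mon v \<and> Poly_Mapping.keys u \<subseteq> V \<and>
      Poly_Mapping.keys v \<subseteq> V \<and> to_frag u - to_frag v \<in> L \<and> u \<noteq> v \<and>
      Poly_Mapping.keys u \<inter> Poly_Mapping.keys v = {}" for b :: "'v mpoly" and u v
  have "\<forall>b\<in>B. \<exists>u v. P b u v" using B(3) unfolding P_def by blast
  then obtain \<alpha> \<beta> where "\<forall>b\<in>B. P b (\<alpha> b) (\<beta> b)" by metis
  then have ab: "\<And>b. b \<in> B \<Longrightarrow> b = mon (\<alpha> b) - mon (\<beta> b)"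
      "\<And>b. b \<in> B \<Longrightarrow> Poly_Mapping.keys (\<alpha> b) \<subseteq> V" "\<And>b. b \<in> B \<Longrightarrow> Poly_Mapping.keys (\<beta> b) \<subseteq> V"
      "\<And>b. b \<in> B \<Longrightarrow> to_frag (\<alpha> b) - to_frag (\<beta> b) \<in> L"
      "\<And>b. b \<in> B \<Longrightarrow> \<alpha> b \<noteq> \<beta> b"
      "\<And>b. b \<in> B \<Longrightarrow> Poly_Mapping.keys (\<alpha> b) \<inter> Poly_Mapping.keys (\<beta> b) = {}"
    unfolding P_def by blast+
  define r where "r b = to_frag (\<alpha> b) - to_frag (\<beta> b)" for b
  note inv = binomial_span_invariant[where \<alpha> = \<alpha> and \<beta> = \<beta> and B = B and V = V]
  have pos: "Poly_Mapping.lookup (r b) v > 0 \<longleftrightarrow> v \<in> Poly_Mapping.keys (\<alpha> b)"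
    and neg: "Poly_Mapping.lookup (r b) v < 0 \<longleftrightarrow> v \<in> Poly_Mapping.keys (\<beta> b)" if "b \<in> B" for b v
  proof -
    have "Poly_Mapping.lookup (\<alpha> b) v = 0 \<or> Poly_Mapping.lookup (\<beta> b) v = 0"
      using ab(6)[OF that] by (auto simp: in_keys_iff)
    then show "Poly_Mapping.lookup (r b) v > 0 \<longleftrightarrow> v \<in> Poly_Mapping.keys (\<alpha> b)"
      "Poly_Mapping.lookup (r b) v < 0 \<longleftrightarrow> v \<in> Poly_Mapping.keys (\<beta> b)"
      unfolding r_def by (auto simp: lookup_minus lookup_to_frag in_keys_iff)
  qed
  let ?M = "\<lambda>b. Poly_Mapping.lookup (r b)"
  have mixed: "mixed_on V (?M b)" if b: "b \<in> B" for b
  proof -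
    have "exp_deg (\<alpha> b) = exp_deg (\<beta> b)"
      using L(3)[OF ab(4)[OF b]] exp_deg_coord_sum[of "\<alpha> b"] exp_deg_coord_sum[of "\<beta> b"]
      unfolding coord_sum_diff by simp
    then have "\<alpha> b \<noteq> 0" "\<beta> b \<noteq> 0" using ab(5)[OF b] exp_deg_eq_0 by metis+
    then obtain p q where "p \<in> Poly_Mapping.keys (\<alpha> b)" "q \<in> Poly_Mapping.keys (\<beta> b)"
      by (metis all_not_in_conv keys_eq_empty)
    then show ?thesis using pos[OF b] neg[OF b] ab(2,3)[OF b] unfolding mixed_on_def by blast
  qed
  have sep: "\<exists>b\<in>B. (\<exists>v\<in>Z. ?M b v \<noteq> 0) \<and> \<not> mixed_on Z (?M b)"
    if Z: "Z \<subseteq> V" "Z \<noteq> {}" "Z \<noteq> V" for Z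
  proof (rule ccontr)
    assume neg_sep: "\<not> ?thesis"
    have "Poly_Mapping.keys (\<alpha> b) \<inter> Z = {} \<longleftrightarrow> Poly_Mapping.keys (\<beta> b) \<inter> Z = {}" if b: "b \<in> B" for b
    proof -
      have "(\<forall>v\<in>Z. ?M b v = 0) \<or> mixed_on Z (?M b)" using neg_sep b by blast
      then show ?thesis
        using pos[OF b] neg[OF b] unfolding mixed_on_def disjoint_iff by (metis less_irrefl)
    qed
    then have QQ: "(Poly_Mapping.keys (t + \<alpha> b) \<inter> Z = {}) = (Poly_Mapping.keys (t + \<beta> b) \<inter> Z = {})"
      if "b \<in> B" for t b using that unfolding keys_add_nat by blast
    obtain j l where jl: "j \<in> Z" "l \<in> V" "l \<notin> Z" using Z by blast
    then obtain m where m: "m > 0" "frag_cmul (int m) (frag_of j - frag_of l) \<in> L" using tors Z by blast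
    let ?u = "Poly_Mapping.single j m" and ?v = "Poly_Mapping.single l m"
    have "mon ?u - mon ?v \<in> lattice_binomials V L"
      using jl Z m by (intro lattice_binomialsI)
        (auto simp: to_frag_single frag.scale_right_diff_distrib[symmetric])
    then have "mon ?u - mon ?v \<in> mpoly.span {mon t * b | t b. Poly_Mapping.keys t \<subseteq> V \<and> b \<in> B}"
      using S by blast
    then have "Poly_Mapping.keys ?u \<inter> Z = {} \<longleftrightarrow> Poly_Mapping.keys ?v \<inter> Z = {}"
      by (rule inv[where Q = "\<lambda>x. Poly_Mapping.keys x \<inter> Z = {}", OF _ ab(1) QQ])
    then show False using jl m by auto
  qed
  have card: "card B < card V" using B(2) F(2) by simp
  have "glued V B ?M"
  proof (rule dominating_imp_glued)
    show "dominating V B ?M" "card V = card B + 1"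
      using dominating_if_separating[where M = ?M, OF V B(1) card sep mixed] by auto
    show "?M b v = 0" if "b \<in> B" "v \<notin> V" for b v
      using L(2)[OF ab(4)[OF that(1)]] that(2) unfolding r_def by (auto simp: in_keys_iff)
  qed (use V B mixed in auto)
  moreover have "L = frag.span (r ` B)"
  proof
    show "frag.span (r ` B) \<subseteq> L" using ab(4) L(1) unfolding r_def by (intro frag.span_minimal) auto
    show "L \<subseteq> frag.span (r ` B)"
    proof
      fix w assume w: "w \<in> L"
      obtain u v where uv: "Poly_Mapping.keys u \<subseteq> V" "Poly_Mapping.keys v \<subseteq> V" "w = to_frag u - to_frag v"
        using frag_as_difference[OF L(2)[OF w]] .
      let ?Q = "\<lambda>x. to_frag u - to_frag x \<in> frag.span (r ` B)"
      have "mon u - mon v \<in> lattice_binomials V L" using uv w by (intro lattice_binomialsI) auto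
      then have "mon u - mon v \<in> mpoly.span {mon t * b | t b. Poly_Mapping.keys t \<subseteq> V \<and> b \<in> B}"
        using S by blast
      then have "?Q u \<longleftrightarrow> ?Q v"
      proof (rule inv[where Q = ?Q, OF _ ab(1)])
        fix t b assume b: "b \<in> B"
        have rb: "r b \<in> frag.span (r ` B)" using b by (auto intro: frag.span_base)
        have e: "to_frag u - to_frag (t + \<beta> b) = r b + (to_frag u - to_frag (t + \<alpha> b))"
          unfolding r_def to_frag_add by simp
        show "?Q (t + \<alpha> b) \<longleftrightarrow> ?Q (t + \<beta> b)" unfolding e frag.span_add_eq[OF rb] ..
      qed
      then show "w \<in> frag.span (r ` B)" unfolding uv(3) by (simp add: frag.span_zero)
    qed
  qed
  ultimately show ?thesis by blast
qed

section \<open>Rank and torsion\<close>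

text \<open>More unknowns than homogeneous equations: eliminate one of the equations with a pivot \<open>p\<close>, without
  dividing.\<close>

lemma integer_relation:
  fixes x :: "'k \<Rightarrow> 'v \<Rightarrow> int"
  assumes "finite V" "finite K" "card V < card K"
  shows "\<exists>c. (\<exists>k\<in>K. c k \<noteq> 0) \<and> (\<forall>v\<in>V. (\<Sum>k\<in>K. c k * x k v) = 0)"
  using assms
proof (induction V arbitrary: K x rule: finite_induct)
  case empty
  then obtain k where "k \<in> K" by fastforce
  then show ?case by (intro exI[of _ "\<lambda>_. 1"]) auto
next
  case (insert v V)
  show ?case
  proof (cases "\<forall>k\<in>K. x k v = 0")
    case True
    have "card V < card K" using insert by simp
    from insert.IH[OF insert.prems(1) this, of x] True show ?thesis by auto
  next
    case False
    then obtain p where p: "p \<in> K" "x p v \<noteq> 0" by blast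
    define y where "y k u = x p v * x k u - x k v * x p u" for k u
    have "card V < card (K - {p})" using insert p by simp
    then obtain c where c: "\<exists>k\<in>K - {p}. c k \<noteq> 0" "\<forall>u\<in>V. (\<Sum>k\<in>K - {p}. c k * y k u) = 0"
      using insert.IH[of "K - {p}" y] insert.prems by auto
    \<comment> \<open>the coefficient of the pivot vector is chosen to cancel the coordinate \<open>v\<close>\<close>
    define d where "d k = (if k = p then - (\<Sum>k\<in>K - {p}. c k * x k v) else c k * x p v)" for k
    have d: "(\<Sum>k\<in>K. d k * x k u) = (\<Sum>k\<in>K - {p}. c k * y k u)" for u
    proof -
      have "(\<Sum>k\<in>K. d k * x k u) = d p * x p u + (\<Sum>k\<in>K - {p}. d k * x k u)"
        using insert.prems p by (simp add: sum.remove)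
      also have "(\<Sum>k\<in>K - {p}. d k * x k u) = (\<Sum>k\<in>K - {p}. c k * x p v * x k u)"
        by (intro sum.cong) (auto simp: d_def)
      also have "d p * x p u = (\<Sum>k\<in>K - {p}. - (c k * x k v * x p u))"
        by (simp add: d_def sum_distrib_right sum_negf)
      finally show ?thesis
        unfolding sum.distrib[symmetric] y_def by (simp add: algebra_simps)
    qed
    have "\<forall>u\<in>insert v V. (\<Sum>k\<in>K. d k * x k u) = 0"
      unfolding d using c(2) by (simp add: y_def)
    moreover have "\<exists>k\<in>K. d k \<noteq> 0" using c(1) p unfolding d_def by auto
    ultimately show ?thesis by blast
  qed
qed

abbreviation sublattice_group :: "('v \<Rightarrow>\<^sub>0 int) set \<Rightarrow> ('v \<Rightarrow>\<^sub>0 int) monoid" where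
  "sublattice_group L \<equiv> (free_Abelian_group UNIV)\<lparr>carrier := L\<rparr>"

lemma sublattice_group_group:
  assumes "frag.subspace L"
  shows "group (sublattice_group L)"
proof -
  have "subgroup L (free_Abelian_group UNIV)"
    by (rule subgroup.intro)
      (use assms frag.subspace_add frag.subspace_0 frag.subspace_neg in auto)
  then show ?thesis by (rule subgroup.subgroup_is_group[OF _ group_free_Abelian_group])
qed

lemma has_rank_unique:
  assumes "frag.subspace L" "has_rank L m" "has_rank L n"
  shows "m = n"
proof -
  have "free_Abelian_group {..<m} \<cong> sublattice_group L"
    using group.iso_sym[OF sublattice_group_group] assms unfolding has_rank_def by blast
  then have "free_Abelian_group {..<m} \<cong> free_Abelian_group {..<n}"
    using assms(3) iso_trans unfolding has_rank_def by blast
  then have "{..<m} \<approx> {..<n}" by (simp only: isomorphic_free_Abelian_groups)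
  then show ?thesis by (simp add: eqpoll_iff_card)
qed

text \<open>A basis of \<open>L\<close> together with \<open>e\<^sub>j - e\<^sub>l\<close> consists of \<open>n + 1\<close> vectors of coordinate sum zero, so their
  entries at the \<open>n\<close> places other than \<open>l\<close> already determine them, and they satisfy a relation. It
  involves \<open>e\<^sub>j - e\<^sub>l\<close> because the basis is independent.\<close>

lemma full_rank_torsion:
  assumes L: "frag.subspace L" "\<And>w. w \<in> L \<Longrightarrow> Poly_Mapping.keys w \<subseteq> V" "\<And>w. w \<in> L \<Longrightarrow> coord_sum w = 0"
    and rank: "has_rank L n" and V: "finite V" "card V = n + 1" and jl: "j \<in> V" "l \<in> V"
  shows "\<exists>m>0. frag_cmul (int m) (frag_of j - frag_of l) \<in> L"
proof -
  have "free_Abelian_group {..<n} \<cong> sublattice_group L"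
    using group.iso_sym[OF sublattice_group_group[OF L(1)]] rank unfolding has_rank_def by blast
  then obtain h where h: "h \<in> iso (free_Abelian_group {..<n}) (sublattice_group L)"
    unfolding is_iso_def by blast
  have hom: "h \<in> hom (free_Abelian_group {..<n}) (free_Abelian_group UNIV)"
    and hL: "\<And>x. Poly_Mapping.keys x \<subseteq> {..<n} \<Longrightarrow> h x \<in> L"
    and inj: "inj_on h (carrier (free_Abelian_group {..<n}))"
    using h unfolding iso_def hom_def bij_betw_def by auto
  define b where "b k = h (frag_of k)" for k
  interpret H: module_hom frag_cmul frag_cmul "frag_extend b" by (rule frag_extend_hom)
  have h0: "h 0 = 0" using hom_frag_diff[OF hom, of 0 0] by simp
  have hb: "h x = frag_extend b x" if "Poly_Mapping.keys x \<subseteq> {..<n}" for x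
    using that
  proof (rule free_Abelian_group_induct)
    show "h (x - y) = frag_extend b (x - y)"
      if "Poly_Mapping.keys x \<subseteq> {..<n}" "Poly_Mapping.keys y \<subseteq> {..<n}"
        "h x = frag_extend b x" "h y = frag_extend b y" for x y
      using hom_frag_diff[OF hom that(1,2)] that(3,4) by (simp add: H.diff)
  qed (simp_all add: h0 b_def)
  \<comment> \<open>the index \<open>n\<close> stands for the vector that is adjoined to the basis \<open>b\<close>\<close>
  define X where "X k v = Poly_Mapping.lookup (if k = n then frag_of j - frag_of l else b k) v" for k v
  have "card (V - {l}) < card {..n}" using V jl by simp
  then obtain c where c: "\<exists>k\<in>{..n}. c k \<noteq> 0" "\<forall>v\<in>V - {l}. (\<Sum>k\<in>{..n}. c k * X k v) = 0"
    using integer_relation[of "V - {l}" "{..n}" X] V by auto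
  define x where "x = (\<Sum>k<n. frag_cmul (c k) (frag_of k))"
  have xl: "Poly_Mapping.lookup x k = (if k < n then c k else 0)" for k
  proof -
    have "Poly_Mapping.lookup x k = (\<Sum>i<n. if i = k then c k else 0)"
      unfolding x_def lookup_sum by (intro sum.cong) auto
    then show ?thesis by simp
  qed
  have xk: "Poly_Mapping.keys x \<subseteq> {..<n}"
    by (rule subsetI, rule ccontr) (simp add: xl in_keys_iff)
  have hx: "h x = (\<Sum>k<n. frag_cmul (c k) (b k))"
    unfolding hb[OF xk] unfolding x_def by (simp add: H.sum H.scale)
  define e where "e = frag_of j - frag_of l"
  define z where "z = h x + frag_cmul (c n) e"
  have zl: "Poly_Mapping.lookup z v = (\<Sum>k\<in>{..n}. c k * X k v)" for v
  proof -
    have "(\<Sum>k\<in>{..n}. c k * X k v) = (\<Sum>k<n. c k * X k v) + c n * X n v"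
      by (simp add: lessThan_Suc_atMost[symmetric])
    also have "(\<Sum>k<n. c k * X k v) = Poly_Mapping.lookup (h x) v"
      unfolding hx lookup_sum by (intro sum.cong) (auto simp: X_def)
    also have "c n * X n v = Poly_Mapping.lookup (frag_cmul (c n) e) v"
      unfolding X_def e_def lookup_frag_cmul by simp
    finally show ?thesis unfolding z_def lookup_add ..
  qed
  have ek: "Poly_Mapping.keys e \<subseteq> V" unfolding e_def using jl keys_diff[of "frag_of j" "frag_of l"] by auto
  have "coord_sum e = 0" unfolding e_def coord_sum_diff by (simp add: coord_sum_def)
  then have zs: "coord_sum z = 0" using L(3)[OF hL[OF xk]] by (simp add: z_def coord_sum_add coord_sum_cmul)
  have zk: "Poly_Mapping.keys z \<subseteq> V"
    using L(2)[OF hL[OF xk]] ek keys_add[of "h x" "frag_cmul (c n) e"] keys_cmul[of "c n" e]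
    unfolding z_def by blast
  have z0: "Poly_Mapping.lookup z v = 0" if "v \<noteq> l" for v
    using that c(2) zk zl by (cases "v \<in> V") (auto simp: in_keys_iff)
  have "coord_sum z = Poly_Mapping.lookup z l"
    using coord_sum_eq[OF V(1) zk] V jl z0 by (simp add: sum.remove[of V l])
  then have "z = 0" using zs z0 by (intro poly_mapping_eqI) (metis lookup_zero)
  then have hxe: "frag_cmul (c n) e = - h x" unfolding z_def by (simp add: eq_neg_iff_add_eq_0 add.commute)
  have "c n \<noteq> 0"
  proof
    assume cn: "c n = 0"
    then have "h x = h 0" using hxe h0 by simp
    then have "x = 0" using inj xk unfolding inj_on_def by auto
    then have "c k = 0" if "k < n" for k using xl[of k] that by simp
    then show False using c(1) cn by (metis atMost_iff le_neq_implies_less)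
  qed
  have "frag_cmul (c n) e \<in> L" unfolding hxe using L(1) hL[OF xk] by (rule frag.subspace_neg)
  moreover have "frag_cmul (int (nat \<bar>c n\<bar>)) e \<in> {frag_cmul (c n) e, - frag_cmul (c n) e}"
    by (cases "c n \<ge> 0") auto
  ultimately have "frag_cmul (int (nat \<bar>c n\<bar>)) e \<in> L" using frag.subspace_neg[OF L(1)] by auto
  then show ?thesis using \<open>c n \<noteq> 0\<close> unfolding e_def by (intro exI[of _ "nat \<bar>c n\<bar>"]) auto
qed

lemma subgroup_free_subspace:
  assumes "subgroup L (free_Abelian_group V)"
  shows "frag.subspace L"
proof -
  interpret G: group "free_Abelian_group V" by simp
  interpret S: subgroup L "free_Abelian_group V" by fact
  have sub: "Poly_Mapping.keys x \<subseteq> V" if "x \<in> L" for x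
    using subsetD[OF S.subset that] by simp
  show ?thesis
  proof (rule frag.subspaceI)
    show "0 \<in> L" using S.one_closed by simp
    show "x + y \<in> L" if "x \<in> L" "y \<in> L" for x y using S.m_closed[OF that] by simp
    show "frag_cmul k x \<in> L" if "x \<in> L" for k x
      using G.subgroup_int_pow_closed[OF assms that, of k] sub[OF that] by simp
  qed
qed

section \<open>Homogenization of toppling ideals\<close>

definition map_exponents :: "(('v \<Rightarrow>\<^sub>0 nat) \<Rightarrow> ('v \<Rightarrow>\<^sub>0 nat)) \<Rightarrow> 'v mpoly \<Rightarrow> 'v mpoly" where
  "map_exponents \<phi> p = (\<Sum>u\<in>Poly_Mapping.keys p. Poly_Mapping.single (\<phi> u) (Poly_Mapping.lookup p u))"

lemma map_exponents_superset:
  assumes "finite A" "Poly_Mapping.keys p \<subseteq> A"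
  shows "map_exponents \<phi> p = (\<Sum>u\<in>A. Poly_Mapping.single (\<phi> u) (Poly_Mapping.lookup p u))"
  unfolding map_exponents_def using assms
  by (intro sum.mono_neutral_left) (auto simp: in_keys_iff)

lemma map_exponents_linear: "Vector_Spaces.linear poly_scale poly_scale (map_exponents \<phi>)"
  unfolding Vector_Spaces.linear_iff
proof (intro conjI allI mpoly.vector_space_axioms)
  fix p q :: "'a mpoly" and c
  let ?A = "Poly_Mapping.keys p \<union> Poly_Mapping.keys q"
  have "map_exponents \<phi> (p + q) = (\<Sum>u\<in>?A. Poly_Mapping.single (\<phi> u) (Poly_Mapping.lookup (p + q) u))"
    using keys_add[of p q] by (intro map_exponents_superset) auto
  also have "\<dots> = (\<Sum>u\<in>?A. Poly_Mapping.single (\<phi> u) (Poly_Mapping.lookup p u))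
      + (\<Sum>u\<in>?A. Poly_Mapping.single (\<phi> u) (Poly_Mapping.lookup q u))"
    unfolding sum.distrib[symmetric] by (intro sum.cong) (auto simp: lookup_add single_add)
  also have "\<dots> = map_exponents \<phi> p + map_exponents \<phi> q"
    by (intro arg_cong2[where f = "(+)"] map_exponents_superset[symmetric]) auto
  finally show "map_exponents \<phi> (p + q) = map_exponents \<phi> p + map_exponents \<phi> q" .
  have "map_exponents \<phi> (poly_scale c p)
    = (\<Sum>u\<in>Poly_Mapping.keys p. Poly_Mapping.single (\<phi> u) (Poly_Mapping.lookup (poly_scale c p) u))"
    by (intro map_exponents_superset) (auto simp: in_keys_iff lookup_poly_scale)
  then show "map_exponents \<phi> (poly_scale c p) = poly_scale c (map_exponents \<phi> p)"
    unfolding map_exponents_def mpoly.scale_sum_right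
    by (simp add: lookup_poly_scale poly_scale_single)
qed

lemma map_exponents_mon: "map_exponents \<phi> (mon u) = mon (\<phi> u)"
  unfolding map_exponents_def by simp

lemma homogenize_eq:
  "homogenize y f = map_exponents (\<lambda>u. u + Poly_Mapping.single y (total_deg f - exp_deg u)) f"
  unfolding homogenize_def map_exponents_def ..

text \<open>Any monomial of \<open>p\<close> can be cancelled against another monomial of \<open>p\<close> in the same class, because
  the coefficients of the class sum to zero. Homogenization needs that no new monomials come in: it
  pads all monomials to the total degree of \<open>p\<close>, which only bounds those that occur in \<open>p\<close>.\<close>

lemma span_own_binomials:
  assumes L: "frag.subspace L"
    and "\<And>u. u \<in> Poly_Mapping.keys p \<Longrightarrow> coeff_sum (\<lambda>x. to_frag x - to_frag u \<in> L) p = 0"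
  shows "p \<in> mpoly.span {mon u - mon v | u v. u \<in> Poly_Mapping.keys p \<and> v \<in> Poly_Mapping.keys p \<and>
      to_frag u - to_frag v \<in> L}"
  using assms(2)
proof (induction "card (Poly_Mapping.keys p)" arbitrary: p rule: less_induct)
  case less
  let ?T = "\<lambda>p :: 'a mpoly. {mon u - mon v | u v. u \<in> Poly_Mapping.keys p \<and> v \<in> Poly_Mapping.keys p \<and>
      to_frag u - to_frag v \<in> L}"
  show ?case
  proof (cases "p = 0")
    case True then show ?thesis by (simp add: mpoly.span_zero)
  next
    case False
    then obtain u where u: "u \<in> Poly_Mapping.keys p" by (metis all_not_in_conv keys_eq_empty)
    let ?c = "Poly_Mapping.lookup p u" and ?Q = "\<lambda>u x. to_frag x - to_frag u \<in> L"
    have uu: "?Q u u" using frag.subspace_0[OF L] by simp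
    have "\<exists>v\<in>Poly_Mapping.keys p. v \<noteq> u \<and> ?Q u v"
    proof (rule ccontr)
      assume n: "\<not> ?thesis"
      have "coeff_sum (?Q u) p = (\<Sum>x\<in>Poly_Mapping.keys p. if x = u then ?c else 0)"
        unfolding coeff_sum_def using n uu by (intro sum.cong) auto
      then show False using less.prems[OF u] u by (simp add: in_keys_iff)
    qed
    then obtain v where v: "v \<in> Poly_Mapping.keys p" "v \<noteq> u" "?Q u v" by blast
    have vu: "to_frag u - to_frag v \<in> L" using frag.subspace_neg[OF L v(3)] by simp
    define q where "q = p - poly_scale ?c (mon u - mon v)"
    have ql: "Poly_Mapping.lookup q x = Poly_Mapping.lookup p x
        - ?c * ((if x = u then 1 else 0) - (if x = v then 1 else 0))" for x
      unfolding q_def by (auto simp: lookup_minus lookup_poly_scale lookup_single when_def)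
    have qk: "Poly_Mapping.keys q \<subseteq> Poly_Mapping.keys p - {u}"
      using v u by (auto simp: ql in_keys_iff split: if_splits)
    have "q \<in> mpoly.span (?T q)"
    proof (rule less.hyps)
      show "card (Poly_Mapping.keys q) < card (Poly_Mapping.keys p)"
        using qk u by (intro psubset_card_mono) auto
      fix w assume "w \<in> Poly_Mapping.keys q"
      then have w: "coeff_sum (?Q w) p = 0" using qk less.prems by blast
      have "?Q w u \<longleftrightarrow> ?Q w v"
      proof
        assume "?Q w u" from frag.subspace_add[OF L v(3) this] show "?Q w v" by simp
      next
        assume "?Q w v" from frag.subspace_add[OF L vu this] show "?Q w u" by simp
      qed
      then show "coeff_sum (?Q w) q = 0"
        unfolding q_def using w by (simp add: coeff_sum_diff coeff_sum_scale coeff_sum_mon)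
    qed
    also have "mpoly.span (?T q) \<subseteq> mpoly.span (?T p)" using qk by (intro mpoly.span_mono) blast
    finally have "q + poly_scale ?c (mon u - mon v) \<in> mpoly.span (?T p)"
      using u v vu by (intro mpoly.span_add mpoly.span_scale) (auto intro!: mpoly.span_base)
    then show ?thesis unfolding q_def by simp
  qed
qed

lemma restrict_frag_hom:
  assumes "finite V"
  shows "module_hom frag_cmul frag_cmul (restrict_frag V)"
  by (intro module_hom.intro frag.module_axioms module_hom_axioms.intro poly_mapping_eqI)
     (simp_all add: lookup_restrict_frag[OF assms] lookup_add)

lemma sum_zero_eqI:
  assumes V: "finite V" "Poly_Mapping.keys a \<subseteq> V" "Poly_Mapping.keys b \<subseteq> V" "s \<in> V"
    and "coord_sum a = coord_sum b" "\<And>v. v \<in> V - {s} \<Longrightarrow> Poly_Mapping.lookup a v = Poly_Mapping.lookup b v"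
  shows "a = b"
proof -
  have "(\<Sum>v\<in>V - {s}. Poly_Mapping.lookup a v) = (\<Sum>v\<in>V - {s}. Poly_Mapping.lookup b v)"
    using assms by (intro sum.cong) auto
  then have "Poly_Mapping.lookup a s = Poly_Mapping.lookup b s"
    using assms(5) coord_sum_eq[OF V(1,2)] coord_sum_eq[OF V(1,3)] V by (simp add: sum.remove)
  then show ?thesis using assms(6) V by (intro poly_mapping_eqI) (metis DiffI in_keys_iff singletonD subsetD)
qed

text \<open>A vector of coordinate sum zero is determined by its coordinates outside \<open>s\<close>. Padding two
  monomials with difference in the projected lattice to a common degree therefore gives a
  difference in \<open>L\<close>. Conversely, a binomial of \<open>L\<close> is a multiple by a power of \<open>x\<^sub>s\<close> of the homogenization
  of the binomial that arises from setting \<open>x\<^sub>s = 1\<close>.\<close>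

lemma homogenization_lattice_ideal:
  assumes V: "finite V" "s \<in> V" and L: "frag.subspace L" "\<And>w. w \<in> L \<Longrightarrow> Poly_Mapping.keys w \<subseteq> V"
    "\<And>w. w \<in> L \<Longrightarrow> coord_sum w = 0"
  shows "homogenization V s (lattice_ideal (V - {s}) (restrict_frag (V - {s}) ` L)) = lattice_ideal V L"
proof
  interpret R: cring "poly_ring V" by (rule poly_ring_cring)
  let ?U = "V - {s}" and ?L = "restrict_frag (V - {s}) ` L"
  have U: "finite ?U" using V by simp
  interpret H: module_hom frag_cmul frag_cmul "restrict_frag ?U" by (rule restrict_frag_hom[OF U])
  have L': "frag.subspace ?L" by (rule H.subspace_image[OF L(1)])
  have deg: "exp_deg u = exp_deg v" if "to_frag u - to_frag v \<in> L" for u v :: "'a \<Rightarrow>\<^sub>0 nat"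
    using L(3)[OF that] exp_deg_coord_sum[of u] exp_deg_coord_sum[of v] unfolding coord_sum_diff by simp
  have hom: "homogenize s f \<in> lattice_ideal V L" if f: "f \<in> lattice_ideal ?U ?L" for f
  proof -
    define \<phi> where "\<phi> u = u + Poly_Mapping.single s (total_deg f - exp_deg u)" for u
    have car: "Poly_Mapping.keys u \<subseteq> ?U" if "u \<in> Poly_Mapping.keys f" for u
    proof -
      have "f \<in> carrier (poly_ring ?U)"
        using f ideal.Icarr[OF lattice_ideal_ideal] by blast
      then show ?thesis using that unfolding in_poly_ring by blast
    qed
    have td: "exp_deg u \<le> total_deg f" if "u \<in> Poly_Mapping.keys f" for u
      unfolding total_deg_def using that by (intro Max_ge) auto
    have "f \<in> mpoly.span {mon u - mon v | u v. u \<in> Poly_Mapping.keys f \<and> v \<in> Poly_Mapping.keys f \<and>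
      to_frag u - to_frag v \<in> ?L}"
    proof (rule span_own_binomials[OF L'])
      fix w
      let ?Q = "\<lambda>x. to_frag x - to_frag w \<in> ?L"
      have Q: "?Q u \<longleftrightarrow> ?Q v" if "to_frag u - to_frag v \<in> ?L" for u v :: "'a \<Rightarrow>\<^sub>0 nat"
      proof
        assume "?Q v" from frag.subspace_add[OF L' that this] show "?Q u" by simp
      next
        assume "?Q u" from frag.subspace_diff[OF L' this that] show "?Q v" by simp
      qed
      show "coeff_sum ?Q f = 0"
      proof (rule coeff_sum_span_0)
        show "f \<in> mpoly.span (lattice_binomials ?U ?L)" using f unfolding lattice_ideal_eq .
        fix t assume "t \<in> lattice_binomials ?U ?L"
        then obtain u v where "t = mon u - mon v" "to_frag u - to_frag v \<in> ?L"
          unfolding lattice_binomials_def by blast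
        then show "coeff_sum ?Q t = 0" using Q[of u v] by (simp add: coeff_sum_diff coeff_sum_mon)
      qed
    qed
    then have "map_exponents \<phi> f \<in> lattice_ideal V L"
      unfolding lattice_ideal_eq
    proof (rule linear_span_image_subset[OF map_exponents_linear, rotated])
      interpret M: Vector_Spaces.linear poly_scale poly_scale "map_exponents \<phi>"
        by (rule map_exponents_linear)
      fix t assume "t \<in> {mon u - mon v | u v. u \<in> Poly_Mapping.keys f \<and> v \<in> Poly_Mapping.keys f \<and>
        to_frag u - to_frag v \<in> ?L}"
      then obtain u v w where t: "t = mon u - mon v" "u \<in> Poly_Mapping.keys f" "v \<in> Poly_Mapping.keys f"
        and w: "w \<in> L" "to_frag u - to_frag v = restrict_frag ?U w" by auto
      have k: "Poly_Mapping.keys (\<phi> x) \<subseteq> V" if "x \<in> Poly_Mapping.keys f" for x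
        using car[OF that] V(2) unfolding \<phi>_def keys_add_nat by auto
      have d: "exp_deg (\<phi> x) = total_deg f" if "x \<in> Poly_Mapping.keys f" for x
        using td[OF that] unfolding \<phi>_def exp_deg_add by simp
      have "to_frag (\<phi> u) - to_frag (\<phi> v) = w"
      proof (rule sum_zero_eqI[OF V(1) _ L(2)[OF w(1)] V(2)])
        show "Poly_Mapping.keys (to_frag (\<phi> u) - to_frag (\<phi> v)) \<subseteq> V"
          using k[OF t(2)] k[OF t(3)] keys_diff[of "to_frag (\<phi> u)" "to_frag (\<phi> v)"]
          unfolding keys_to_frag by blast
        show "coord_sum (to_frag (\<phi> u) - to_frag (\<phi> v)) = coord_sum w"
          using L(3)[OF w(1)] d t by (simp add: coord_sum_diff exp_deg_coord_sum[symmetric])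
        fix x assume x: "x \<in> ?U"
        have "Poly_Mapping.lookup (to_frag (\<phi> u) - to_frag (\<phi> v)) x = Poly_Mapping.lookup (to_frag u - to_frag v) x"
          using x unfolding \<phi>_def to_frag_add by (simp add: lookup_minus lookup_add to_frag_single)
        also have "\<dots> = Poly_Mapping.lookup w x"
          unfolding w(2) using x by (simp add: lookup_restrict_frag[OF U])
        finally show "Poly_Mapping.lookup (to_frag (\<phi> u) - to_frag (\<phi> v)) x = Poly_Mapping.lookup w x" .
      qed
      then have "mon (\<phi> u) - mon (\<phi> v) \<in> lattice_binomials V L"
        using k t w by (intro lattice_binomialsI) auto
      then show "map_exponents \<phi> t \<in> mpoly.span (lattice_binomials V L)"
        unfolding t(1) by (simp add: M.diff map_exponents_mon mpoly.span_base)
    qed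
    then show ?thesis unfolding homogenize_eq \<phi>_def .
  qed
  then show "homogenization V s (lattice_ideal ?U ?L) \<subseteq> lattice_ideal V L"
    unfolding homogenization_def by (intro R.genideal_minimal lattice_ideal_ideal) auto
  let ?I = "homogenization V s (lattice_ideal ?U ?L)"
  have hc: "homogenize s ` lattice_ideal ?U ?L \<subseteq> carrier (poly_ring V)"
    using hom ideal.Icarr[OF lattice_ideal_ideal] by blast
  have I: "ideal ?I (poly_ring V)"
    unfolding homogenization_def by (rule R.genideal_ideal[OF hc])
  note sub = ideal_subspace[OF I]
  have bin: "mon u - mon v \<in> ?I"
    if uv: "Poly_Mapping.keys u \<subseteq> V" "Poly_Mapping.keys v \<subseteq> V" "to_frag u - to_frag v \<in> L"
      and le: "Poly_Mapping.lookup u s \<le> Poly_Mapping.lookup v s" for u v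
  proof (cases "u = v")
    case True then show ?thesis using mpoly.subspace_0[OF sub] by simp
  next
    case False
    define i j where "i = Poly_Mapping.lookup u s" and "j = Poly_Mapping.lookup v s"
    define u' v' where "u' = u - Poly_Mapping.single s i" and "v' = v - Poly_Mapping.single s j"
    have us: "u = u' + Poly_Mapping.single s i" "v = v' + Poly_Mapping.single s j"
      unfolding u'_def v'_def i_def j_def
      by (auto intro!: poly_mapping_eqI simp: lookup_add lookup_minus lookup_single when_def)
    have k: "Poly_Mapping.keys u' \<subseteq> ?U" "Poly_Mapping.keys v' \<subseteq> ?U"
      using uv unfolding u'_def v'_def i_def j_def
      by (auto simp: in_keys_iff lookup_minus lookup_single when_def split: if_splits)
    have out: "Poly_Mapping.lookup u' x = 0" "Poly_Mapping.lookup v' x = 0" if "x \<notin> ?U" for x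
      using k that by (auto simp: in_keys_iff)
    have "to_frag u' - to_frag v' = restrict_frag ?U (to_frag u - to_frag v)"
    proof (rule poly_mapping_eqI)
      fix x
      show "Poly_Mapping.lookup (to_frag u' - to_frag v') x
          = Poly_Mapping.lookup (restrict_frag ?U (to_frag u - to_frag v)) x"
        using out[of x] unfolding us
        by (cases "x \<in> ?U")
          (auto simp: lookup_restrict_frag[OF U] lookup_minus lookup_add to_frag_add to_frag_single
            lookup_to_frag)
    qed
    then have "mon u' - mon v' \<in> lattice_ideal ?U ?L"
      unfolding lattice_ideal_eq using uv k by (intro mpoly.span_base lattice_binomialsI) auto
    moreover have d: "exp_deg u' + i = exp_deg v' + j"
      using deg[OF uv(3)] unfolding us exp_deg_add by simp
    have ne: "u' \<noteq> v'" using False d us by auto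
    have kf: "Poly_Mapping.keys (mon u' - mon v') = {u', v'}"
      using ne by (auto simp: in_keys_iff lookup_minus lookup_single when_def split: if_splits)
    have "i \<le> j" using le unfolding i_def j_def .
    then have td: "total_deg (mon u' - mon v') = exp_deg u'"
      using d unfolding total_deg_def kf by simp
    let ?\<phi> = "\<lambda>w. w + Poly_Mapping.single s (exp_deg u' - exp_deg w)"
    interpret M: Vector_Spaces.linear poly_scale poly_scale "map_exponents ?\<phi>"
      by (rule map_exponents_linear)
    have "homogenize s (mon u' - mon v') = mon u' - mon (v' + Poly_Mapping.single s (exp_deg u' - exp_deg v'))"
      unfolding homogenize_eq td M.diff map_exponents_mon by simp
    moreover have "j = i + (exp_deg u' - exp_deg v')" using d \<open>i \<le> j\<close> by simp
    ultimately have "mon (Poly_Mapping.single s i) * homogenize s (mon u' - mon v') = mon u - mon v"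
      unfolding us by (simp add: right_diff_distrib mult_single single_add ac_simps)
    moreover have "homogenize s (mon u' - mon v') \<in> ?I"
      unfolding homogenization_def
      using R.genideal_self[OF hc] \<open>mon u' - mon v' \<in> lattice_ideal ?U ?L\<close> by blast
    moreover have "mon (Poly_Mapping.single s i) \<in> carrier (poly_ring V)"
      using V(2) by (auto simp: in_poly_ring)
    ultimately show ?thesis using ideal.I_l_closed[OF I] by fastforce
  qed
  have "lattice_binomials V L \<subseteq> ?I"
  proof
    fix p assume "p \<in> lattice_binomials V L"
    then obtain u v where uv: "p = mon u - mon v" "Poly_Mapping.keys u \<subseteq> V" "Poly_Mapping.keys v \<subseteq> V"
      "to_frag u - to_frag v \<in> L" unfolding lattice_binomials_def by blast
    show "p \<in> ?I"
    proof (cases "Poly_Mapping.lookup u s \<le> Poly_Mapping.lookup v s")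
      case True then show ?thesis using bin uv by blast
    next
      case False
      have "to_frag v - to_frag u \<in> L" using frag.subspace_neg[OF L(1) uv(4)] by simp
      then have "mon v - mon u \<in> ?I" using bin uv False by simp
      then show ?thesis using mpoly.subspace_neg[OF sub] uv(1) by fastforce
    qed
  qed
  then have "mpoly.span (lattice_binomials V L) \<subseteq> ?I" using sub by (rule mpoly.span_minimal)
  then show "lattice_ideal V L \<subseteq> ?I" by (simp only: lattice_ideal_eq[of V L])
qed

lemma reduced_laplacian_lattice:
  assumes G: "sandpile_graph G" "absolute_sink G"
  shows "reduced_laplacian G ` carrier (free_Abelian_group (nonsink G))
    = restrict_frag (nonsink G) ` laplacian_lattice G"
proof -
  have fin: "finite (verts G)" "finite (nonsink G)" and s: "sink G \<in> verts G"
    using G unfolding sandpile_graph_def nonsink_def by auto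
  interpret H: module_hom frag_cmul frag_cmul "restrict_frag (nonsink G)"
    by (rule restrict_frag_hom[OF fin(2)])
  interpret D: module_hom frag_cmul frag_cmul "reduced_laplacian G"
    unfolding reduced_laplacian_def by (rule frag_extend_hom)
  let ?l = "\<lambda>v. laplacian G (frag_of v)"
  have red: "reduced_laplacian G (frag_of v) = restrict_frag (nonsink G) (?l v)" if v: "v \<in> nonsink G" for v
  proof (rule poly_mapping_eqI)
    fix u
    have "Poly_Mapping.lookup (\<Sum>w\<in>nonsink G. frag_cmul (int (wt G v w)) (frag_of w)) u
      = (\<Sum>w\<in>nonsink G. if w = u then int (wt G v u) else 0)"
      unfolding lookup_sum by (intro sum.cong) auto
    then show "Poly_Mapping.lookup (reduced_laplacian G (frag_of v)) u
        = Poly_Mapping.lookup (restrict_frag (nonsink G) (?l v)) u"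
      using fin v unfolding reduced_laplacian_def
      by (auto simp: lookup_minus lookup_restrict_frag lookup_laplacian nonsink_def)
  qed
  have "?l (sink G) = 0"
    using G(2) absolute_sink_wt_zero[OF G] unfolding absolute_sink_def
    by (intro poly_mapping_eqI) (auto simp: lookup_laplacian[OF fin(1)])
  moreover have "verts G = insert (sink G) (nonsink G)" using s unfolding nonsink_def by auto
  ultimately have "frag.span (?l ` verts G) = frag.span (?l ` nonsink G)"
    unfolding frag.span_eq by (auto intro: frag.span_base frag.span_zero)
  then have "restrict_frag (nonsink G) ` laplacian_lattice G
      = frag.span (restrict_frag (nonsink G) ` ?l ` nonsink G)"
    unfolding laplacian_lattice_eq_span[OF fin(1)] H.span_image by simp
  also have "restrict_frag (nonsink G) ` ?l ` nonsink G = reduced_laplacian G ` frag_of ` nonsink G"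
    using red by (auto simp: image_image)
  also have "frag.span \<dots> = reduced_laplacian G ` carrier (free_Abelian_group (nonsink G))"
    unfolding D.span_image carrier_free_eq_span[OF fin(2)] ..
  finally show ?thesis ..
qed

section \<open>Lattices of complete intersections\<close>

theorem theorem8p11:
  fixes n :: nat and L :: "(nat \<Rightarrow>\<^sub>0 int) set"
  assumes "subgroup L (free_Abelian_group {1..n+1})"
    and "has_rank L n"
    and "lattice_complete_intersection {1..n+1} L"
  shows "\<exists>G :: nat multigraph. completely_wired G \<and> verts G = {1..n+1} \<and>
           laplacian_lattice G = L \<and>
           lattice_ideal {1..n+1} L = homogenization (verts G) (sink G) (toppling_ideal G)"
proof -
  let ?V = "{1..n+1}"
  have sub: "frag.subspace L" using assms(1) by (rule subgroup_free_subspace)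
  have keys: "Poly_Mapping.keys w \<subseteq> ?V" if "w \<in> L" for w
    using subsetD[OF subgroup.subset[OF assms(1)] that] by simp
  obtain r f where rf: "has_rank L r" "\<And>i. i < r \<Longrightarrow> f i \<in> carrier (poly_ring ?V)"
    "\<And>i. i < r \<Longrightarrow> homogeneous (f i)" "lattice_ideal ?V L = genideal (poly_ring ?V) (f ` {..<r})"
    using assms(3) unfolding lattice_complete_intersection_def by blast
  have r: "r = n" using has_rank_unique[OF sub rf(1) assms(2)] .
  let ?F = "f ` {..<r}"
  have F: "?F \<subseteq> carrier (poly_ring ?V)" "\<And>p. p \<in> ?F \<Longrightarrow> homogeneous p" using rf by auto
  have sum0: "coord_sum w = 0" if "w \<in> L" for w
    using lattice_coord_sum_zero[OF rf(4) F(1) F(2) that keys[OF that]] .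
  have "card ?F < card ?V" using card_image_le[of "{..<r}" f] r by simp
  then obtain B :: "nat mpoly set" and \<rho> where
    B: "glued ?V B (\<lambda>b. Poly_Mapping.lookup (\<rho> b))" "L = frag.span (\<rho> ` B)"
    using complete_intersection_glued[OF _ sub keys sum0 full_rank_torsion[OF sub keys sum0 assms(2)] rf(4) F(1)]
    by auto
  have "coord_sum (\<rho> b) = 0" if "b \<in> B" for b
  proof (rule sum0)
    show "\<rho> b \<in> L" unfolding B(2) using that by (intro frag.span_base) simp
  qed
  then obtain G where G: "completely_wired G" "sandpile_graph G" "absolute_sink G" "verts G = ?V"
    "laplacian_lattice G = L"
    using glued_imp_completely_wired[OF B(1)] B(2) by auto
  have "sink G \<in> ?V" using G unfolding sandpile_graph_def by auto
  then have "homogenization ?V (sink G) (toppling_ideal G) = lattice_ideal ?V L"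
    unfolding toppling_ideal_def reduced_laplacian_lattice[OF G(2,3)] G(5)
    unfolding nonsink_def G(4)
    by (intro homogenization_lattice_ideal sub keys sum0) auto
  then show ?thesis using G by auto
qed

end
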